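(* Suppose that $C_2$ is a constant, independent of $\alpha,\beta$, such that the Jacobi–Littlewood–Paley $g$-functions satisfy $$\|g^{(\alpha,\beta)}f\|_{2,(\alpha,\beta)}\le C_2\,\|f\|_{2,(\alpha,\beta)}$$ for all $\alpha,\beta>-1$ and all $f\in L^2((-1,1),\mu_{\alpha,\beta})$. Then, with the same constant $C_2$: (i) the Gaussian–Littlewood–Paley $g$-function satisfies $\|g^{\gamma}f\|_{2,\gamma}\le C_2\,\|f\|_{2,\gamma}$ for all $f\in L^2(\mathbb{R},\gamma)$; (ii) for every $\alpha>-1$, the Laguerre–Littlewood–Paley $g$-function satisfies $\|g^{\alpha}f\|_{2,\alpha}\le C_2\,\|f\|_{2,\alpha}$ for all $f\in L^2((0,\infty),\mu_\alpha)$.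
   Context: Everything is in dimension one; functions are real valued. Polynomials are normalized as in Szegő's book. **Subordination.** Given a semigroup $\{T_t\}_{t>0}$, its Poisson (subordinated) semigroup is $P_tf(x)=\frac{1}{\sqrt\pi}\int_0^\infty \frac{e^{-u}}{\sqrt u}\,T_{t^2/(4u)}f(x)\,du$, $t>0$. **Jacobi setting.** For $\alpha,\beta>-1$, $\mu_{\alpha,\beta}$ is the probability measure on $(-1,1)$ given by $\mu_{\alpha,\beta}(dx)=\eta_{\alpha,\beta}(1-x)^\alpha(1+x)^\beta dx$, with $\eta_{\alpha,\beta}=\frac{\Gamma(\alpha+\beta+2)}{2^{\alpha+\beta+1}\Gamma(\alpha+1)\Gamma(\beta+1)}$. Let $P_k^{(\alpha,\beta)}$, $k\ge0$, be the Jacobi polynomials (orthogonal with respect to $\mu_{\alpha,\beta}$, $\deg P_k^{(\alpha,\beta)}=k$), $\hat h_k^{(\alpha,\beta)}=\int_{-1}^1 (P_k^{(\alpha,\beta)})^2\,d\mu_{\alpha,\beta}$ and $\lambda_k=k(k+\alpha+\beta+1)$. The Jacobi semigroup is $$T_t^{\alpha,\beta}f(x)=\int_{-1}^1\Big(\sum_{k\ge0}\frac{e^{-\lambda_k t}}{\hat h_k^{(\alpha,\beta)}}P_k^{(\alpha,\beta)}(x)P_k^{(\alpha,\beta)}(y)\Big)f(y)\,\mu_{\alpha,\beta}(dy),$$ and $P_t^{(\alpha,\beta)}$ is its subordinated semigroup; so $P_t^{(\alpha,\beta)}P_k^{(\alpha,\beta)}=e^{-t\sqrt{\lambda_k}}P_k^{(\alpha,\beta)}$.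 The Jacobi–Littlewood–Paley $g$-function is $$g^{(\alpha,\beta)}f(x)=\Big(\int_0^\infty t\Big[\big(\tfrac{\partial}{\partial t}P_t^{(\alpha,\beta)}f(x)\big)^2+(1-x^2)\big(\tfrac{\partial}{\partial x}P_t^{(\alpha,\beta)}f(x)\big)^2\Big]dt\Big)^{1/2}.$$ **Hermite (Gaussian) setting.** $\gamma(dx)=\pi^{-1/2}e^{-x^2}dx$ on $\mathbb{R}$; $H_k$ are the Hermite polynomials, orthogonal with respect to $\gamma$ with $\int H_k^2\,d\gamma=2^kk!$. The semigroup is $T_t^\gamma f(x)=\int_{\mathbb{R}}\big(\sum_{k\ge0}\frac{e^{-kt}}{2^kk!}H_k(x)H_k(y)\big)f(y)\,\gamma(dy)$ and $P_t^\gamma$ is its subordinated semigroup; so $P_t^\gamma H_k=e^{-t\sqrt k}H_k$. The Gaussian–Littlewood–Paley $g$-function is $$g^{\gamma}f(x)=\Big(\int_0^\infty t\Big[\big(\tfrac{\partial}{\partial t}P_t^{\gamma}f(x)\big)^2+\tfrac12\big(\tfrac{\partial}{\partial x}P_t^{\gamma}f(x)\big)^2\Big]dt\Big)^{1/2}.$$ **Laguerre setting.** For $\alpha>-1$, $\mu_\alpha(dx)=\frac{x^\alpha e^{-x}}{\Gamma(\alpha+1)}dx$ on $(0,\infty)$; $L_k^\alpha$ are the Laguerre polynomials, orthogonal with respect to $\mu_\alpha$ with $\int (L_k^\alpha)^2\,d\mu_\alpha=\frac{\Gamma(k+\alpha+1)}{\Gamma(\alpha+1)k!}$. The semigroup is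 $T_t^\alpha f(x)=\int_0^\infty\big(\sum_{k\ge0}e^{-kt}\frac{\Gamma(\alpha+1)k!}{\Gamma(k+\alpha+1)}L_k^\alpha(x)L_k^\alpha(y)\big)f(y)\,\mu_\alpha(dy)$ and $P_t^\alpha$ is its subordinated semigroup; so $P_t^\alpha L_k^\alpha=e^{-t\sqrt k}L_k^\alpha$. The Laguerre–Littlewood–Paley $g$-function is $$g^{\alpha}f(x)=\Big(\int_0^\infty t\Big[\big(\tfrac{\partial}{\partial t}P_t^{\alpha}f(x)\big)^2+x\big(\tfrac{\partial}{\partial x}P_t^{\alpha}f(x)\big)^2\Big]dt\Big)^{1/2}.$$ **Norms.** $\|\cdot\|_{p,(\alpha,\beta)}$, $\|\cdot\|_{p,\gamma}$, $\|\cdot\|_{p,\alpha}$ denote the norms of $L^p((-1,1),\mu_{\alpha,\beta})$, $L^p(\mathbb{R},\gamma)$ and $L^p((0,\infty),\mu_\alpha)$ respectively. *)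

theory Defs
  imports "HOL-Analysis.Analysis"
begin

section \<open>$L^2$ spaces and norms\<close>

definition ennreal_sqrt :: "ennreal \<Rightarrow> ennreal" where
  "ennreal_sqrt x = (if x = top then top else ennreal (sqrt (enn2real x)))"

definition L2_space :: "real measure \<Rightarrow> (real \<Rightarrow> real) set" where
  "L2_space M = {f \<in> borel_measurable M. integrable M (\<lambda>x. (f x)\<^sup>2)}"

text \<open>The norm is defined for \<open>[0,\<infinity>]\<close>-valued functions, so that a \<open>g\<close>-function which is infinite
  at some points, or not square integrable, has the correct norm.\<close>

definition L2_norm :: "real measure \<Rightarrow> (real \<Rightarrow> ennreal) \<Rightarrow> ennreal" where
  "L2_norm M F = ennreal_sqrt (\<integral>\<^sup>+x. (F x)\<^sup>2 \<partial>M)"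

abbreviation L2_norm_real :: "real measure \<Rightarrow> (real \<Rightarrow> real) \<Rightarrow> ennreal" where
  "L2_norm_real M f \<equiv> L2_norm M (\<lambda>x. ennreal \<bar>f x\<bar>)"

section \<open>Subordination and Littlewood--Paley functions\<close>

definition subordinated ::
  "(real \<Rightarrow> (real \<Rightarrow> real) \<Rightarrow> real \<Rightarrow> real) \<Rightarrow> real \<Rightarrow> (real \<Rightarrow> real) \<Rightarrow> real \<Rightarrow> real" where
  "subordinated T t f x =
     1 / sqrt pi * (LINT u:{0<..}|lborel. exp (- u) / sqrt u * T (t\<^sup>2 / (4 * u)) f x)"

text \<open>The three \<open>g\<close>-functions have the same form; only the semigroup and the coefficient \<open>w\<close> of
  the squared spatial derivative differ.\<close>

definition littlewood_paley_g ::
  "(real \<Rightarrow> real) \<Rightarrow> (real \<Rightarrow> (real \<Rightarrow> real) \<Rightarrow> real \<Rightarrow> real) \<Rightarrow> (real \<Rightarrow> real) \<Rightarrow> real \<Rightarrow> ennreal" where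
  "littlewood_paley_g w P f x =
     ennreal_sqrt (\<integral>\<^sup>+t\<in>{0<..}. ennreal (t * ((deriv (\<lambda>s. P s f x) t)\<^sup>2
                                         + w x * (deriv (\<lambda>y. P t f y) x)\<^sup>2)) \<partial>lborel)"

section \<open>Jacobi setting\<close>

definition jacobi_measure :: "real \<Rightarrow> real \<Rightarrow> real measure" where
  "jacobi_measure \<alpha> \<beta> = density (restrict_space lborel {-1<..<1})
     (\<lambda>x. ennreal (Gamma (\<alpha> + \<beta> + 2) / (2 powr (\<alpha> + \<beta> + 1) * Gamma (\<alpha> + 1) * Gamma (\<beta> + 1))
                   * (1 - x) powr \<alpha> * (1 + x) powr \<beta>))"

text \<open>Szego's normalization, \<open>P\<^sub>k(1) = (k + \<alpha>) gchoose k\<close>, in the explicit form (4.3.2) of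
  \<^emph>\<open>Orthogonal Polynomials\<close>.\<close>

definition jacobi_poly :: "real \<Rightarrow> real \<Rightarrow> nat \<Rightarrow> real \<Rightarrow> real" where
  "jacobi_poly \<alpha> \<beta> k x =
     (\<Sum>j\<le>k. ((real k + \<alpha>) gchoose (k - j)) * ((real k + \<beta>) gchoose j)
             * ((x - 1) / 2) ^ j * ((x + 1) / 2) ^ (k - j))"

definition jacobi_hhat :: "real \<Rightarrow> real \<Rightarrow> nat \<Rightarrow> real" where
  "jacobi_hhat \<alpha> \<beta> k = (LINT x|jacobi_measure \<alpha> \<beta>. (jacobi_poly \<alpha> \<beta> k x)\<^sup>2)"

definition jacobi_lambda :: "real \<Rightarrow> real \<Rightarrow> nat \<Rightarrow> real" where
  "jacobi_lambda \<alpha> \<beta> k = real k * (real k + \<alpha> + \<beta> + 1)"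

definition jacobi_semigroup ::
  "real \<Rightarrow> real \<Rightarrow> real \<Rightarrow> (real \<Rightarrow> real) \<Rightarrow> real \<Rightarrow> real" where
  "jacobi_semigroup \<alpha> \<beta> t f x =
     (LINT y|jacobi_measure \<alpha> \<beta>.
        (\<Sum>k. exp (- jacobi_lambda \<alpha> \<beta> k * t) / jacobi_hhat \<alpha> \<beta> k
             * jacobi_poly \<alpha> \<beta> k x * jacobi_poly \<alpha> \<beta> k y) * f y)"

definition jacobi_g :: "real \<Rightarrow> real \<Rightarrow> (real \<Rightarrow> real) \<Rightarrow> real \<Rightarrow> ennreal" where
  "jacobi_g \<alpha> \<beta> = littlewood_paley_g (\<lambda>x. 1 - x\<^sup>2) (subordinated (jacobi_semigroup \<alpha> \<beta>))"

section \<open>Hermite (Gaussian) setting\<close>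

definition gauss_measure :: "real measure" where
  "gauss_measure = density lborel (\<lambda>x. ennreal (exp (- x\<^sup>2) / sqrt pi))"

text \<open>The physicists' Hermite polynomials, Szego (5.5.4).\<close>

definition hermite_poly :: "nat \<Rightarrow> real \<Rightarrow> real" where
  "hermite_poly k x =
     fact k * (\<Sum>j\<le>k div 2. (-1) ^ j * (2 * x) ^ (k - 2 * j) / (fact j * fact (k - 2 * j)))"

definition hermite_semigroup :: "real \<Rightarrow> (real \<Rightarrow> real) \<Rightarrow> real \<Rightarrow> real" where
  "hermite_semigroup t f x =
     (LINT y|gauss_measure.
        (\<Sum>k. exp (- real k * t) / (2 ^ k * fact k) * hermite_poly k x * hermite_poly k y) * f y)"

definition gauss_g :: "(real \<Rightarrow> real) \<Rightarrow> real \<Rightarrow> ennreal" where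
  "gauss_g = littlewood_paley_g (\<lambda>x. 1 / 2) (subordinated hermite_semigroup)"

section \<open>Laguerre setting\<close>

definition laguerre_measure :: "real \<Rightarrow> real measure" where
  "laguerre_measure \<alpha> = density (restrict_space lborel {0<..})
     (\<lambda>x. ennreal (x powr \<alpha> * exp (- x) / Gamma (\<alpha> + 1)))"

text \<open>Szego (5.1.6).\<close>

definition laguerre_poly :: "real \<Rightarrow> nat \<Rightarrow> real \<Rightarrow> real" where
  "laguerre_poly \<alpha> k x = (\<Sum>j\<le>k. ((real k + \<alpha>) gchoose (k - j)) * (- x) ^ j / fact j)"

definition laguerre_semigroup :: "real \<Rightarrow> real \<Rightarrow> (real \<Rightarrow> real) \<Rightarrow> real \<Rightarrow> real" where
  "laguerre_semigroup \<alpha> t f x =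
     (LINT y|laguerre_measure \<alpha>.
        (\<Sum>k. exp (- real k * t) * (Gamma (\<alpha> + 1) * fact k / Gamma (real k + \<alpha> + 1))
             * laguerre_poly \<alpha> k x * laguerre_poly \<alpha> k y) * f y)"

definition laguerre_g :: "real \<Rightarrow> (real \<Rightarrow> real) \<Rightarrow> real \<Rightarrow> ennreal" where
  "laguerre_g \<alpha> = littlewood_paley_g (\<lambda>x. x) (subordinated (laguerre_semigroup \<alpha>))"

end

theory Submission
  imports Defs "HOL-Probability.Distributions" "HOL-Real_Asymp.Real_Asymp"
begin

text \<open>Integrating the square function term by term gives, in each of the three settings,
  \<open>\<parallel>g f\<parallel>\<^sup>2 = (1/2) \<Sum>\<^sub>k\<^sub>\<ge>\<^sub>1 c\<^sub>k\<^sup>2\<close>, where \<open>c\<^sub>k\<close> are the coefficients of \<open>f\<close> in the normalized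
  eigenpolynomials: the time derivative and the space derivative contribute \<open>c\<^sub>k\<^sup>2 / 4\<close> each. The
  Legendre polynomial of degree one therefore forces \<open>C\<^sub>2 \<ge> 1 / sqrt 2\<close>, while Fatou's lemma and
  Bessel's inequality give \<open>\<parallel>g f\<parallel> \<le> \<parallel>f\<parallel> / sqrt 2\<close> for Hermite and Laguerre expansions. Pointwise
  convergence of all series rests on an energy estimate for the eigenvalue equation
  \<open>W p'' + Q p' + \<lambda> p = 0\<close>, which bounds \<open>p\<close> locally uniformly in \<open>\<lambda>\<close>.\<close>

section \<open>Subordination of exponentials\<close>

text \<open>The two derivatives contribute equally because of Green's formula: integrating W p_j'
  p_k' against the weight gives the eigenvalue on the diagonal and 0 off it, exactly what the two
  factors sqrt lambda of the time derivative give by orthogonality. Integrating t exp(-2 t sqrt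
  lambda_k) over t > 0 gives 1 / (4 lambda_k), hence c_k^2 / 4 from each. So the constant 1 / sqrt 2
  depends neither on the weight nor on the polynomials, and passing from the Jacobi setting to the
  others becomes a comparison of real numbers instead of a limit in the parameters. The obstacle is
  that g is built from \<open>deriv\<close>: for arbitrary f in L2 and at every interior point, the
  kernel integral, the subordination integral and both derivatives must be exchanged with infinite
  sums. This calls for bounds on the normalized polynomials near x that hold for all degrees at
  once. The energy argument takes them from the differential equation alone, which is why one locale
  can serve all three weights.\<close>

lemma integral_atLeast_gauss: "(LINT s:{0..}|lborel. exp (- s\<^sup>2)) = sqrt pi / 2"
  using gaussian_moment_0 by (simp add: has_bochner_integral_iff set_lebesgue_integral_def)

text \<open>An error function normalized to vanish at minus infinity. The boundary values of the
  primitive in \<open>subordination_integral\<close> are read off from its limits and its value at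
  0.\<close>

lemma gauss_primitive:
  obtains G :: "real \<Rightarrow> real" where "\<And>x. (G has_real_derivative exp (- x\<^sup>2)) (at x)"
    "(G \<longlongrightarrow> sqrt pi) at_top" "(G \<longlongrightarrow> 0) at_bot" "G 0 = sqrt pi / 2"
proof -
  let ?e = "\<lambda>s::real. exp (- s\<^sup>2)"
  define F where "F x = (LBINT s=ereal 0..ereal x. ?e s)" for x
  have der: "(F has_real_derivative ?e x) (at x)" for x
  proof -
    \<comment> \<open>An interval that contains 0 and has x in its interior, so that the derivative
      within the interval is the full derivative.\<close>
    define c where "c = - \<bar>x\<bar> - 1"
    define d where "d = \<bar>x\<bar> + 1"
    have "((\<lambda>u. LBINT s=ereal 0..ereal u. ?e s) has_vector_derivative ?e x) (at x within {c..d})"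
      by (rule interval_integral_FTC2[of c 0 d]) (auto simp: c_def d_def intro!: continuous_intros)
    then have "(F has_real_derivative ?e x) (at x within {c..d})"
      by (simp add: has_real_derivative_iff_has_vector_derivative F_def[abs_def])
    moreover have "at x within {c..d} = at x" by (rule at_within_Icc_at) (auto simp: c_def d_def)
    ultimately show ?thesis by (simp only:)
  qed
  have F0: "F 0 = 0" by (simp add: F_def)
  have top: "(F \<longlongrightarrow> sqrt pi / 2) at_top"
  proof -
    have "set_integrable lborel {0..} ?e"
      using gaussian_moment_0 by (simp add: has_bochner_integral_iff set_integrable_def)
    then have "((\<lambda>b. LINT s:{0..b}|lborel. ?e s) \<longlongrightarrow> (LINT s:{0..}|lborel. ?e s)) at_top"
      by (intro tendsto_set_lebesgue_integral_at_top) auto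
    moreover have "\<forall>\<^sub>F b in at_top. (LINT s:{0..b}|lborel. ?e s) = F b"
      using eventually_ge_at_top[of "0::real"]
    proof eventually_elim
      case (elim b)
      then show ?case by (simp add: F_def interval_integral_Icc)
    qed
    ultimately show ?thesis
      unfolding integral_atLeast_gauss by (rule Lim_transform_eventually)
  qed
  have odd: "F (- x) = - F x" for x
  proof -
    have "((\<lambda>x. F (- x) + F x) has_real_derivative exp (- (- x)\<^sup>2) * (- 1) + exp (- x\<^sup>2)) (at x)" for x
      by (rule DERIV_add[OF DERIV_chain2[OF der DERIV_minus[OF DERIV_ident]] der])
    then have "((\<lambda>x. F (- x) + F x) has_real_derivative 0) (at x)" for x by simp
    from DERIV_isconst_all[OF allI[OF this], of x 0] F0 show ?thesis by simp
  qed
  have bot: "(F \<longlongrightarrow> - (sqrt pi / 2)) at_bot"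
  proof -
    have "((\<lambda>x. F (- x)) \<longlongrightarrow> - (sqrt pi / 2)) at_top"
      unfolding odd by (intro tendsto_minus top)
    then show ?thesis by (simp add: filterlim_at_bot_mirror)
  qed
  show thesis
  proof (rule that[of "\<lambda>x. F x + sqrt pi / 2"])
    show "((\<lambda>x. F x + sqrt pi / 2) has_real_derivative exp (- x\<^sup>2)) (at x)" for x
      using DERIV_add[OF der DERIV_const] by simp
    show "((\<lambda>x. F x + sqrt pi / 2) \<longlongrightarrow> sqrt pi) at_top"
      using tendsto_add[OF top tendsto_const[of "sqrt pi / 2"]] by simp
    show "((\<lambda>x. F x + sqrt pi / 2) \<longlongrightarrow> 0) at_bot"
      using tendsto_add[OF bot tendsto_const[of "sqrt pi / 2"]] by simp
  qed (simp add: F0)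
qed

text \<open>With a = t sqrt \<lambda> this is the subordination formula that turns exp(-\<lambda>
  t^2 / (4 u)) into exp(-t sqrt \<lambda>). The integrand has an explicit primitive, found by
  completing the square in the exponent in both possible ways.\<close>

lemma subordination_integral:
  fixes a :: real
  assumes "a \<ge> 0"
  shows "set_integrable lborel {0<..} (\<lambda>u. exp (- u) / sqrt u * exp (- a\<^sup>2 / (4 * u)))" (is ?A)
    and "(LINT u:{0<..}|lborel. exp (- u) / sqrt u * exp (- a\<^sup>2 / (4 * u))) = sqrt pi * exp (- a)" (is ?B)
proof -
  obtain G :: "real \<Rightarrow> real" where G: "\<And>x. (G has_real_derivative exp (- x\<^sup>2)) (at x)"
    "(G \<longlongrightarrow> sqrt pi) at_top" "(G \<longlongrightarrow> 0) at_bot" "G 0 = sqrt pi / 2"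
    by (rule gauss_primitive) blast
  \<comment> \<open>\<open>F\<close> is a primitive of the integrand: \<open>(sqrt u \<plusminus> a / (2 sqrt u))\<^sup>2 = u + a\<^sup>2 / (4 u) \<plusminus> a\<close>.\<close>
  define F where "F u = exp a * G (sqrt u + a / (2 * sqrt u)) + exp (- a) * G (sqrt u - a / (2 * sqrt u))" for u
  let ?f = "\<lambda>u. exp (- u) / sqrt u * exp (- a\<^sup>2 / (4 * u))"
  have der: "(F has_real_derivative ?f u) (at u)" if u: "u > 0" for u
  proof -
    define s where "s = sqrt u"
    have s: "s > 0" "s * s = u" using u by (auto simp: s_def)
    have sq: "((\<lambda>u. sqrt u) has_real_derivative (inverse s / 2)) (at u)"
      unfolding s_def using u by (rule DERIV_real_sqrt)
    have d1: "((\<lambda>u. sqrt u + a / (2 * sqrt u)) has_real_derivative (inverse s / 2 - a * inverse s / (4 * u))) (at u)"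
      using s u by (auto intro!: derivative_eq_intros sq simp: s_def[symmetric] field_simps power2_eq_square)
    have d2: "((\<lambda>u. sqrt u - a / (2 * sqrt u)) has_real_derivative (inverse s / 2 + a * inverse s / (4 * u))) (at u)"
      using s u by (auto intro!: derivative_eq_intros sq simp: s_def[symmetric] field_simps power2_eq_square)
    have e1: "exp a * exp (- (s + a / (2 * s))\<^sup>2) = exp (- u) * exp (- a\<^sup>2 / (4 * u))"
    proof -
      have "a + - (s + a / (2 * s))\<^sup>2 = - u + - a\<^sup>2 / (4 * u)"
        using s by (simp add: field_simps power2_eq_square flip: s(2))
      then show ?thesis by (metis exp_add)
    qed
    have e2: "exp (- a) * exp (- (s - a / (2 * s))\<^sup>2) = exp (- u) * exp (- a\<^sup>2 / (4 * u))"
    proof -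
      have "- a + - (s - a / (2 * s))\<^sup>2 = - u + - a\<^sup>2 / (4 * u)"
        using s by (simp add: field_simps power2_eq_square flip: s(2))
      then show ?thesis by (metis exp_add)
    qed
    have "(F has_real_derivative
        exp a * (exp (- (s + a / (2 * s))\<^sup>2) * (inverse s / 2 - a * inverse s / (4 * u)))
        + exp (- a) * (exp (- (s - a / (2 * s))\<^sup>2) * (inverse s / 2 + a * inverse s / (4 * u)))) (at u)"
      unfolding F_def
      by (intro DERIV_add DERIV_cmult DERIV_chain2[OF _ d1] DERIV_chain2[OF _ d2])
        (use G(1) in \<open>auto simp: s_def\<close>)
    also have "exp a * (exp (- (s + a / (2 * s))\<^sup>2) * (inverse s / 2 - a * inverse s / (4 * u)))
        + exp (- a) * (exp (- (s - a / (2 * s))\<^sup>2) * (inverse s / 2 + a * inverse s / (4 * u)))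
      = (exp (- u) * exp (- a\<^sup>2 / (4 * u))) * (inverse s / 2 - a * inverse s / (4 * u))
       + (exp (- u) * exp (- a\<^sup>2 / (4 * u))) * (inverse s / 2 + a * inverse s / (4 * u))"
      unfolding mult.assoc[symmetric] e1 e2 by simp
    also have "\<dots> = ?f u"
      by (simp add: field_simps flip: s_def)
    finally show ?thesis .
  qed
  have top: "(F \<longlongrightarrow> exp a * sqrt pi + exp (- a) * sqrt pi) at_top"
  proof -
    have "filterlim (\<lambda>u. sqrt u + a / (2 * sqrt u)) at_top at_top" by real_asymp
    moreover have "filterlim (\<lambda>u. sqrt u - a / (2 * sqrt u)) at_top at_top" by real_asymp
    ultimately show ?thesis unfolding F_def
      by (intro tendsto_intros filterlim_compose[OF G(2)])
  qed
  have zero: "(F \<longlongrightarrow> exp a * sqrt pi) (at_right 0)"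
  \<comment> \<open>As u tends to 0, sqrt u - a / (2 sqrt u) tends to minus infinity for positive a
    but to 0 for a = 0, where both arguments of \<open>G\<close> coincide.\<close>
  proof (cases "a = 0")
    case True
    have "((\<lambda>u. 2 * G (sqrt u)) \<longlongrightarrow> 2 * G (sqrt 0)) (at_right 0)"
      using G(1) DERIV_isCont by (intro tendsto_intros isCont_tendsto_compose[of _ G]) auto
    moreover have "F = (\<lambda>u. 2 * G (sqrt u))" "2 * G (sqrt 0) = exp a * sqrt pi"
      using True G(4) by (simp_all add: F_def[abs_def])
    ultimately show ?thesis by (simp only:)
  next
    case False
    with assms have a: "a > 0" by simp
    have "filterlim (\<lambda>u. sqrt u + a / (2 * sqrt u)) at_top (at_right 0)" using a by real_asymp
    moreover have "filterlim (\<lambda>u. sqrt u - a / (2 * sqrt u)) at_bot (at_right 0)" using a by real_asymp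
    ultimately have "(F \<longlongrightarrow> exp a * sqrt pi + exp (- a) * 0) (at_right 0)" unfolding F_def
      by (intro tendsto_intros filterlim_compose[OF G(2)] filterlim_compose[OF G(3)])
    then show ?thesis by simp
  qed
  have ftc: "set_integrable lborel (einterval 0 \<infinity>) ?f"
    "(LBINT u=0..\<infinity>. ?f u) = (exp a * sqrt pi + exp (- a) * sqrt pi) - exp a * sqrt pi"
  proof -
    have A: "((F \<circ> real_of_ereal) \<longlongrightarrow> exp a * sqrt pi) (at_right 0)"
      using zero by (simp add: zero_ereal_def ereal_tendsto_simps)
    have B: "((F \<circ> real_of_ereal) \<longlongrightarrow> exp a * sqrt pi + exp (- a) * sqrt pi) (at_left \<infinity>)"
      using top by (simp add: ereal_tendsto_simps)
    show "set_integrable lborel (einterval 0 \<infinity>) ?f"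
      "(LBINT u=0..\<infinity>. ?f u) = (exp a * sqrt pi + exp (- a) * sqrt pi) - exp a * sqrt pi"
      by (rule interval_integral_FTC_nonneg[OF _ der _ _ A B];
          auto intro!: continuous_intros)+
  qed
  have int: "einterval 0 \<infinity> = {0<..}" by (simp add: zero_ereal_def)
  show ?A using ftc(1) unfolding int .
  show ?B using ftc(2) by (simp add: interval_lebesgue_integral_def int)
qed

section \<open>Convergence of exponential series and the integral of t exp(-s t)\<close>

lemma summable_exp_mult:
  fixes \<Lambda> :: "nat \<Rightarrow> real"
  assumes "\<And>k. real k \<le> \<Lambda> k" "s > 0"
  shows "summable (\<lambda>k. exp (- \<Lambda> k * s))"
proof (rule summable_comparison_test')
  show "summable (\<lambda>k. exp (- s) ^ k)" using assms(2) by (intro summable_geometric) auto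
  show "norm (exp (- \<Lambda> k * s)) \<le> exp (- s) ^ k" for k
    using assms by (simp flip: exp_of_nat_mult)
qed

lemma summable_exp_sqrt:
  fixes \<Lambda> :: "nat \<Rightarrow> real"
  assumes "\<And>k. real k \<le> \<Lambda> k" "t > 0"
  shows "summable (\<lambda>k. exp (- t * sqrt (\<Lambda> k)))"
proof (rule summable_comparison_test')
  have "(\<lambda>k::nat. exp (- t * sqrt (real k))) \<in> O(\<lambda>k. 1 / real k ^ 2)"
    using \<open>t > 0\<close> by real_asymp
  then show "summable (\<lambda>k::nat. exp (- t * sqrt (real k)))"
    by (rule summable_comparison_test_bigo[rotated]) (use inverse_power_summable[of 2] in \<open>simp add: field_simps\<close>)
qed (use assms in auto)

text \<open>Half of the exponential decay absorbs the factor \<open>sqrt (\<Lambda> k)\<close>,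
  because s is at most exp s.\<close>

lemma summable_sqrt_exp_sqrt:
  fixes \<Lambda> :: "nat \<Rightarrow> real"
  assumes "\<And>k. real k \<le> \<Lambda> k" "t > 0"
  shows "summable (\<lambda>k. sqrt (\<Lambda> k) * exp (- t * sqrt (\<Lambda> k)))"
proof (rule summable_comparison_test')
  show "summable (\<lambda>k. 2 / t * exp (- (t / 2) * sqrt (\<Lambda> k)))"
    using assms by (intro summable_mult summable_exp_sqrt) auto
  fix k
  have "0 \<le> \<Lambda> k" using assms(1)[of k] by linarith
  have "t / 2 * sqrt (\<Lambda> k) \<le> exp (t / 2 * sqrt (\<Lambda> k))"
    using exp_ge_add_one_self[of "t / 2 * sqrt (\<Lambda> k)"] by linarith
  then have "sqrt (\<Lambda> k) \<le> 2 / t * exp (t / 2 * sqrt (\<Lambda> k))"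
    using \<open>t > 0\<close> by (simp add: field_simps)
  then have "sqrt (\<Lambda> k) * exp (- t * sqrt (\<Lambda> k)) \<le> 2 / t * exp (t / 2 * sqrt (\<Lambda> k)) * exp (- t * sqrt (\<Lambda> k))"
    by (rule mult_right_mono) simp
  also have "\<dots> = 2 / t * exp (- (t / 2) * sqrt (\<Lambda> k))"
    by (simp add: mult.assoc flip: exp_add)
  finally show "norm (sqrt (\<Lambda> k) * exp (- t * sqrt (\<Lambda> k))) \<le> 2 / t * exp (- (t / 2) * sqrt (\<Lambda> k))"
    using \<open>0 \<le> \<Lambda> k\<close> by simp
qed

lemma integral_t_exp:
  fixes s :: real
  assumes "s > 0"
  shows "set_integrable lborel {0<..} (\<lambda>t. t * exp (- s * t))"
    and "(LINT t:{0<..}|lborel. t * exp (- s * t)) = 1 / s\<^sup>2"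
proof -
  let ?F = "\<lambda>t. - (t / s + 1 / s\<^sup>2) * exp (- s * t)"
  have A: "((?F \<circ> real_of_ereal) \<longlongrightarrow> - 1 / s\<^sup>2) (at_right 0)"
  proof -
    have "(?F \<longlongrightarrow> - 1 / s\<^sup>2) (at_right 0)"
      using assms by real_asymp
    then show ?thesis by (simp add: zero_ereal_def ereal_tendsto_simps)
  qed
  have B: "((?F \<circ> real_of_ereal) \<longlongrightarrow> 0) (at_left \<infinity>)"
  proof -
    have "(?F \<longlongrightarrow> 0) at_top" using assms by real_asymp
    then show ?thesis by (simp add: ereal_tendsto_simps)
  qed
  have der: "(?F has_real_derivative t * exp (- s * t)) (at t)" for t
    using assms by (auto intro!: derivative_eq_intros simp: field_simps power2_eq_square)
  have int: "einterval 0 \<infinity> = {0<..}" by (simp add: zero_ereal_def)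
  have ftc: "set_integrable lborel (einterval 0 \<infinity>) (\<lambda>t. t * exp (- s * t))"
    "(LBINT t=0..\<infinity>. t * exp (- s * t)) = 0 - - 1 / s\<^sup>2"
    using interval_integral_FTC_nonneg[OF _ der _ _ A B] by (auto intro!: continuous_intros AE_I2)
  show "set_integrable lborel {0<..} (\<lambda>t. t * exp (- s * t))" using ftc(1) unfolding int .
  show "(LINT t:{0<..}|lborel. t * exp (- s * t)) = 1 / s\<^sup>2"
    using ftc(2) by (simp add: interval_lebesgue_integral_def int)
qed

section \<open>Weights of Pearson type\<close>

text \<open>The Pearson equation (W \<rho>)' = Q \<rho> puts the operator W u'' + Q u' in the
  divergence form (W \<rho> u')' / \<rho>, which is symmetric with respect to \<rho>. Integrating by
  parts with polynomials leaves boundary terms of the form polynomial times W \<rho>, and the two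
  limit conditions remove them. Extended real endpoints cover bounded, half-infinite and infinite
  intervals together.\<close>

locale diffusion_weight =
  fixes a b :: ereal and \<rho> :: "real \<Rightarrow> real" and W Q :: "real poly"
  assumes a_less_b: "a < b"
    and rho_pos: "\<And>x. x \<in> einterval a b \<Longrightarrow> 0 < \<rho> x"
    and W_pos: "\<And>x. x \<in> einterval a b \<Longrightarrow> 0 < poly W x"
    and W_rho_deriv: "\<And>x. x \<in> einterval a b \<Longrightarrow>
      ((\<lambda>x. poly W x * \<rho> x) has_real_derivative poly Q x * \<rho> x) (at x)"
    and integrable_poly_rho: "\<And>r. set_integrable lborel (einterval a b) (\<lambda>x. poly r x * \<rho> x)"
    and lim_left: "\<And>r. (((\<lambda>x. poly r x * (poly W x * \<rho> x)) \<circ> real_of_ereal) \<longlongrightarrow> 0) (at_right a)"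
    and lim_right: "\<And>r. (((\<lambda>x. poly r x * (poly W x * \<rho> x)) \<circ> real_of_ereal) \<longlongrightarrow> 0) (at_left b)"
begin

abbreviation I :: "real set" where "I \<equiv> einterval a b"

definition M :: "real measure" where
  "M = density (restrict_space lborel I) (\<lambda>x. ennreal (\<rho> x))"

lemma space_M: "space M = I"
  by (simp add: M_def)

lemma sets_M: "sets M = sets (restrict_space borel I)"
  by (simp add: M_def sets_restrict_space)

text \<open>Differentiability is assumed of W \<rho>; dividing by the positive W recovers continuity
  of \<rho>.\<close>

lemma isCont_rho: "isCont \<rho> x" if "x \<in> I"
proof -
  have "isCont (\<lambda>x. poly W x * \<rho> x / poly W x) x"
    using W_pos[OF that] DERIV_isCont[OF W_rho_deriv[OF that]] by (intro isCont_divide) auto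
  moreover have "\<forall>\<^sub>F y in nhds x. y \<in> I"
    using that by (intro eventually_nhds_in_open) auto
  then have "\<forall>\<^sub>F y in nhds x. poly W y * \<rho> y / poly W y = \<rho> y"
    by eventually_elim (use W_pos in force)
  ultimately show ?thesis using isCont_cong by fast
qed

lemma rho_measurable: "\<rho> \<in> borel_measurable (restrict_space borel I)"
  by (intro borel_measurable_continuous_on_restrict continuous_at_imp_continuous_on ballI isCont_rho)

lemma rho_measurable_lborel: "\<rho> \<in> borel_measurable (restrict_space lborel I)"
  using rho_measurable by (simp cong: measurable_cong_sets sets_restrict_space_cong)

lemma borel_measurable_M: "f \<in> borel_measurable M" if "f \<in> borel_measurable borel" for f :: "real \<Rightarrow> 'a :: topological_space"
  using measurable_restrict_space1[OF that, of I] sets_M measurable_cong_sets by blast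

lemma integrable_M_iff:
  fixes f :: "real \<Rightarrow> real"
  assumes [measurable]: "f \<in> borel_measurable borel"
  shows "integrable M f \<longleftrightarrow> set_integrable lborel I (\<lambda>x. f x * \<rho> x)"
proof -
  have "integrable M f \<longleftrightarrow> integrable (restrict_space lborel I) (\<lambda>x. \<rho> x *\<^sub>R f x)"
    unfolding M_def using rho_pos
    by (intro integrable_density rho_measurable_lborel)
      (auto simp: AE_restrict_space_iff less_imp_le measurable_restrict_space1)
  also have "\<dots> \<longleftrightarrow> set_integrable lborel I (\<lambda>x. f x * \<rho> x)"
    by (simp add: integrable_restrict_space set_integrable_def mult.commute)
  finally show ?thesis .
qed

lemma integral_M:
  fixes f :: "real \<Rightarrow> real"
  assumes [measurable]: "f \<in> borel_measurable borel"
  shows "(LINT x|M. f x) = (LINT x:I|lborel. f x * \<rho> x)"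
proof -
  have "integral\<^sup>L M f = (LINT x|restrict_space lborel I. \<rho> x *\<^sub>R f x)"
    unfolding M_def using rho_pos
    by (intro integral_density rho_measurable_lborel)
      (auto simp: AE_restrict_space_iff less_imp_le measurable_restrict_space1)
  also have "\<dots> = (LINT x:I|lborel. f x * \<rho> x)"
    by (simp add: integral_restrict_space set_lebesgue_integral_def mult.commute)
  finally show ?thesis .
qed

lemma borel_measurable_poly [measurable]: "poly r \<in> borel_measurable borel" for r :: "real poly"
  by (intro borel_measurable_continuous_onI continuous_intros)

lemma integrable_poly: "integrable M (poly r)"
  using integrable_M_iff[of "poly r"] integrable_poly_rho by simp

text \<open>Green's formula: by the eigenvalue equation, (W u' v' - l u v) \<rho> is the derivative
  of v u' W \<rho>, which vanishes at both ends of the interval.\<close>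

lemma weak_eigen:
  assumes ode: "W * pderiv (pderiv u) + Q * pderiv u + smult l u = 0"
  shows "l * (LINT x|M. poly (u * v) x) = (LINT x|M. poly (W * pderiv u * pderiv v) x)"
proof -
  let ?F = "\<lambda>x. poly (v * pderiv u) x * (poly W x * \<rho> x)"
  let ?r = "W * pderiv u * pderiv v - smult l (u * v)"
  have der: "(?F has_real_derivative poly ?r x * \<rho> x) (at x)" if x: "x \<in> I" for x
  proof -
    have eq: "poly W x * poly (pderiv (pderiv u)) x + poly Q x * poly (pderiv u) x + l * poly u x = 0"
      using arg_cong[OF ode, of "\<lambda>p. poly p x"] by simp
    have "(?F has_real_derivative poly (v * pderiv u) x * (poly Q x * \<rho> x)
        + poly (pderiv (v * pderiv u)) x * (poly W x * \<rho> x)) (at x)"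
      by (rule DERIV_mult'[OF poly_DERIV W_rho_deriv[OF x]])
    also have "poly (v * pderiv u) x * (poly Q x * \<rho> x)
        + poly (pderiv (v * pderiv u)) x * (poly W x * \<rho> x)
      = \<rho> x * (poly v x * (poly W x * poly (pderiv (pderiv u)) x + poly Q x * poly (pderiv u) x)
          + poly W x * poly (pderiv u) x * poly (pderiv v) x)"
      by (simp add: pderiv_mult algebra_simps)
    also have "poly W x * poly (pderiv (pderiv u)) x + poly Q x * poly (pderiv u) x = - l * poly u x"
      using eq by simp
    finally show ?thesis by (simp add: algebra_simps)
  qed
  have "(LBINT x=a..b. poly ?r x * \<rho> x) = 0 - 0"
    by (rule interval_integral_FTC_integrable[OF a_less_b _ _ integrable_poly_rho lim_left lim_right])
      (auto simp flip: has_real_derivative_iff_has_vector_derivative simp del: poly_diff poly_mult poly_smult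
        simp: einterval_iff intro!: der isCont_rho continuous_intros)
  then have "(LINT x|M. poly ?r x) = 0"
    using a_less_b by (subst integral_M) (auto simp: interval_lebesgue_integral_def split: if_splits)
  then have "(LINT x|M. poly (W * pderiv u * pderiv v) x - poly (smult l (u * v)) x) = 0"
    by (simp only: poly_diff)
  then have "(LINT x|M. poly (W * pderiv u * pderiv v) x) = (LINT x|M. poly (smult l (u * v)) x)"
    by (subst (asm) Bochner_Integration.integral_diff[OF integrable_poly integrable_poly]) (simp del: poly_mult poly_smult)
  moreover have "poly (smult l (u * v)) = (\<lambda>x. l * poly (u * v) x)"
    by (rule ext) (rule poly_smult)
  then have "(LINT x|M. poly (smult l (u * v)) x) = l * (LINT x|M. poly (u * v) x)"
    by (simp del: poly_mult poly_smult)
  ultimately show ?thesis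
    by (simp del: poly_mult poly_smult)
qed

text \<open>The energy \<open>l u\<^sup>2 + W u'\<^sup>2\<close> of an eigenpolynomial satisfies \<open>\<bar>E'\<bar> \<le> K E\<close> on compact
  intervals, with \<open>K\<close> depending only on the weight; so its values are controlled by its mean, which
  is \<open>2 l \<parallel>u\<parallel>\<^sup>2\<close>.\<close>

lemma energy_bound:
  assumes "c < d" "{c..d} \<subseteq> I"
  shows "\<exists>C\<ge>0. \<forall>u l. l \<ge> 0 \<longrightarrow> W * pderiv (pderiv u) + Q * pderiv u + smult l u = 0 \<longrightarrow>
    (\<forall>x\<in>{c..d}. l * (poly u x)\<^sup>2 + poly W x * (poly (pderiv u) x)\<^sup>2 \<le> C * l * (LINT x|M. (poly u x)\<^sup>2))"
proof -
  \<comment> \<open>Inserting the equation in E' = 2 l u u' + W' u'^2 + 2 u' (W u'') cancels the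
    terms with u u' and leaves (W' - 2 Q) u'^2 = R W u'^2, so \<open>l\<close> disappears from the
    growth rate.\<close>
  define R where "R x = (poly (pderiv W) x - 2 * poly Q x) / poly W x" for x
  have cont: "continuous_on {c..d} R" "continuous_on {c..d} \<rho>"
    unfolding R_def using assms W_pos isCont_rho
    by (auto intro!: continuous_intros continuous_at_imp_continuous_on simp: less_imp_neq[symmetric] subset_iff
       dest!: W_pos)
  obtain K where K: "\<And>x. x \<in> {c..d} \<Longrightarrow> \<bar>R x\<bar> \<le> K"
    using compact_imp_bounded[OF compact_continuous_image[OF cont(1) compact_Icc]]
    unfolding bounded_iff real_norm_def by blast
  have K0: "0 \<le> K" using K[of c] \<open>c < d\<close> by auto
  obtain z where z: "z \<in> {c..d}" "\<And>x. x \<in> {c..d} \<Longrightarrow> \<rho> z \<le> \<rho> x"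
    using continuous_attains_inf[OF _ _ cont(2)] \<open>c < d\<close> by fastforce
  have rz: "0 < \<rho> z" using z assms rho_pos by auto
  \<comment> \<open>On [c, d] the energy stays above exp(-K (d - c)) times its value at x, and the
    density stays above its minimum \<open>\<rho> z\<close>. So \<open>m\<close> times the energy at
    x is at most the integral of the energy against \<open>M\<close>.\<close>
  define m where "m = \<rho> z * exp (- K * (d - c)) * (d - c)"
  have m: "m > 0" using rz \<open>c < d\<close> by (simp add: m_def)
  show ?thesis
  proof (intro exI[of _ "2 / m"] conjI allI impI ballI)
    show "0 \<le> 2 / m" using m by simp
    fix u l x assume l: "0 \<le> l" and ode: "W * pderiv (pderiv u) + Q * pderiv u + smult l u = 0"
      and x: "x \<in> {c..d}"
    define e where "e = smult l (u * u) + W * pderiv u * pderiv u"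
    have e: "poly e y = l * (poly u y)\<^sup>2 + poly W y * (poly (pderiv u) y)\<^sup>2" for y
      by (simp add: e_def power2_eq_square algebra_simps)
    have e0: "0 \<le> poly e y" if "y \<in> I" for y
      using W_pos[OF that] l by (simp add: e)
    have de: "\<bar>poly (pderiv e) y\<bar> \<le> K * poly e y" if y: "y \<in> {c..d}" for y
    proof -
      have yI: "y \<in> I" using y assms by auto
      have eq: "poly W y * poly (pderiv (pderiv u)) y = - (poly Q y * poly (pderiv u) y + l * poly u y)"
        using arg_cong[OF ode, of "\<lambda>p. poly p y"] by simp
      have "poly (pderiv e) y = 2 * l * poly u y * poly (pderiv u) y
          + poly (pderiv W) y * (poly (pderiv u) y)\<^sup>2
          + 2 * poly (pderiv u) y * (poly W y * poly (pderiv (pderiv u)) y)"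
        by (simp add: e_def pderiv_mult pderiv_add pderiv_smult power2_eq_square algebra_simps)
      also have "\<dots> = R y * (poly W y * (poly (pderiv u) y)\<^sup>2)"
        unfolding eq R_def using W_pos[OF yI] by (simp add: power2_eq_square field_simps)
      finally have "\<bar>poly (pderiv e) y\<bar> = \<bar>R y\<bar> * (poly W y * (poly (pderiv u) y)\<^sup>2)"
        using W_pos[OF yI] by (simp add: abs_mult)
      also have "\<dots> \<le> K * poly e y"
        using K[OF y] K0 l W_pos[OF yI] unfolding e by (intro mult_mono) auto
      finally show ?thesis .
    qed
    \<comment> \<open>Gronwall's argument in both directions, since x may lie on either side of the
      point of comparison.\<close>
    have up: "poly e s * exp (- K * s) \<ge> poly e t * exp (- K * t)"
      and down: "poly e s * exp (K * s) \<le> poly e t * exp (K * t)"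
      if "s \<le> t" "c \<le> s" "t \<le> d" for s t
    proof -
      have d1: "((\<lambda>y. poly e y * exp (- K * y)) has_real_derivative
          (poly (pderiv e) y - K * poly e y) * exp (- K * y)) (at y)" for y
        by (auto intro!: derivative_eq_intros poly_DERIV simp: algebra_simps)
      show "poly e s * exp (- K * s) \<ge> poly e t * exp (- K * t)"
      proof (rule DERIV_nonpos_imp_nonincreasing[OF \<open>s \<le> t\<close>, of "\<lambda>y. poly e y * exp (- K * y)"])
        fix y assume "s \<le> y" "y \<le> t"
        then have "(poly (pderiv e) y - K * poly e y) * exp (- K * y) \<le> 0"
          using de[of y] that by (auto simp: mult_le_0_iff)
        then show "\<exists>D. ((\<lambda>y. poly e y * exp (- K * y)) has_real_derivative D) (at y) \<and> D \<le> 0"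
          using d1 by blast
      qed
      have d2: "((\<lambda>y. poly e y * exp (K * y)) has_real_derivative
          (poly (pderiv e) y + K * poly e y) * exp (K * y)) (at y)" for y
        by (auto intro!: derivative_eq_intros poly_DERIV simp: algebra_simps)
      show "poly e s * exp (K * s) \<le> poly e t * exp (K * t)"
      proof (rule DERIV_nonneg_imp_nondecreasing[OF \<open>s \<le> t\<close>, of "\<lambda>y. poly e y * exp (K * y)"])
        fix y assume "s \<le> y" "y \<le> t"
        then have "0 \<le> (poly (pderiv e) y + K * poly e y) * exp (K * y)"
          using de[of y] that by (auto simp: zero_le_mult_iff)
        then show "\<exists>D. ((\<lambda>y. poly e y * exp (K * y)) has_real_derivative D) (at y) \<and> 0 \<le> D"
          using d2 by blast
      qed
    qed
    have cmp: "poly e x * exp (- K * (d - c)) \<le> poly e y" if y: "y \<in> {c..d}" for y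
    proof -
      have "poly e x * exp (- K * \<bar>y - x\<bar>) \<le> poly e y"
      proof (cases "x \<le> y")
        case True
        then have "poly e x * exp (K * x) * exp (- K * y) \<le> poly e y * exp (K * y) * exp (- K * y)"
          using down[of x y] x y by (intro mult_right_mono) auto
        then show ?thesis using True by (simp add: mult.assoc algebra_simps flip: exp_add)
      next
        case False
        then have "poly e x * exp (- K * x) * exp (K * y) \<le> poly e y * exp (- K * y) * exp (K * y)"
          using up[of y x] x y by (intro mult_right_mono) auto
        then show ?thesis using False by (simp add: mult.assoc algebra_simps flip: exp_add)
      qed
      moreover have "exp (- K * (d - c)) \<le> exp (- K * \<bar>y - x\<bar>)"
        using x y K0 by (auto intro!: mult_left_mono)
      ultimately show ?thesis
        using e0[of x] x assms by (meson mult_left_mono order_trans subsetD)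
    qed
    have "m * poly e x = (LINT y|lborel. indicator {c..d} y * (\<rho> z * (poly e x * exp (- K * (d - c)))))"
      using \<open>c < d\<close> by (simp add: m_def)
    also have "\<dots> \<le> (LINT y|lborel. indicator I y * (poly e y * \<rho> y))"
    proof (rule integral_mono)
      show "integrable lborel (\<lambda>y. indicator {c..d} y * (\<rho> z * (poly e x * exp (- K * (d - c)))))"
        by (intro integrable_mult_left integrable_real_indicator) (auto simp: emeasure_lborel_Icc_eq)
      show "integrable lborel (\<lambda>y. indicator I y * (poly e y * \<rho> y))"
        using integrable_poly_rho[of e] by (simp add: set_integrable_def)
      fix y
      show "indicator {c..d} y * (\<rho> z * (poly e x * exp (- K * (d - c)))) \<le> indicator I y * (poly e y * \<rho> y)"
      proof (cases "y \<in> {c..d}")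
        case True
        then have "\<rho> z * (poly e x * exp (- K * (d - c))) \<le> \<rho> y * poly e y"
          using z cmp e0[of x] x assms rho_pos[of y] by (intro mult_mono) (auto simp: subset_iff)
        then show ?thesis using True assms by (auto simp: mult.commute)
      next
        case False
        then show ?thesis using e0[of y] rho_pos[of y] by (auto simp: indicator_def)
      qed
    qed
    also have "\<dots> = (LINT y|M. poly e y)"
      by (subst integral_M) (auto simp: set_lebesgue_integral_def)
    also have "\<dots> = (LINT y|M. l * poly (u * u) y + poly (W * pderiv u * pderiv u) y)"
      by (simp add: e_def)
    also have "\<dots> = 2 * l * (LINT y|M. poly (u * u) y)"
      by (subst Bochner_Integration.integral_add)
       (simp_all only: integrable_poly integrable_mult_right integral_mult_right_zero weak_eigen[OF ode, symmetric])
    finally show "l * (poly u x)\<^sup>2 + poly W x * (poly (pderiv u) x)\<^sup>2 \<le> 2 / m * l * (LINT x|M. (poly u x)\<^sup>2)"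
      using m by (simp add: e field_simps power2_eq_square)
  qed
qed

end

section \<open>Poisson series of eigenpolynomials\<close>

text \<open>Sum and integral may be exchanged because the integrals of the absolute values are known
  exactly from the subordination formula: they equal sqrt pi exp(-t
  sqrt(\<open>\<Lambda> k\<close>)) times |\<open>d k\<close>|, a summable sequence.\<close>

lemma subordinate_series:
  fixes \<Lambda> d :: "nat \<Rightarrow> real"
  assumes L: "\<And>k. real k \<le> \<Lambda> k" and d: "\<And>k. \<bar>d k\<bar> \<le> D" and t: "t > 0"
  shows "(LINT u:{0<..}|lborel. exp (- u) / sqrt u * (\<Sum>k. exp (- \<Lambda> k * (t\<^sup>2 / (4 * u))) * d k))
    = sqrt pi * (\<Sum>k. exp (- t * sqrt (\<Lambda> k)) * d k)"
proof -
  have L0: "0 \<le> \<Lambda> k" for k using L[of k] by linarith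
  have sq: "(t * sqrt (\<Lambda> k))\<^sup>2 = \<Lambda> k * t\<^sup>2" for k using L0 by (simp add: power_mult_distrib)
  define h where "h k u = indicator {0<..} u *\<^sub>R (exp (- u) / sqrt u * exp (- (t * sqrt (\<Lambda> k))\<^sup>2 / (4 * u)))" for k u
  have h0: "0 \<le> h k u" for k u by (auto simp: h_def indicator_def)
  have int: "integrable lborel (h k)" "integral\<^sup>L lborel (h k) = sqrt pi * exp (- t * sqrt (\<Lambda> k))" for k
    using subordination_integral[of "t * sqrt (\<Lambda> k)"] L0[of k] t
    by (simp_all add: h_def[abs_def] set_integrable_def set_lebesgue_integral_def)
  have D: "0 \<le> D" using d[of 0] by linarith
  note sum_exp = summable_exp_mult[OF L]
  have summable_h: "summable (\<lambda>k. norm (h k u * d k))" for u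
  proof (cases "u > 0")
    case True
    have "summable (\<lambda>k. exp (- u) / sqrt u * D * exp (- \<Lambda> k * (t\<^sup>2 / (4 * u))))"
      using True t by (intro summable_mult sum_exp) auto
    then show ?thesis
    proof (rule summable_comparison_test')
      fix k
      have "norm (norm (h k u * d k)) = h k u * \<bar>d k\<bar>" using h0[of k u] by (simp add: abs_mult)
      also have "\<dots> \<le> h k u * D" using h0 d by (intro mult_left_mono)
      also have "\<dots> = exp (- u) / sqrt u * D * exp (- \<Lambda> k * (t\<^sup>2 / (4 * u)))"
        using True by (simp add: h_def sq)
      finally show "norm (norm (h k u * d k)) \<le> exp (- u) / sqrt u * D * exp (- \<Lambda> k * (t\<^sup>2 / (4 * u)))" .
    qed
  qed (simp add: h_def)
  have summable_int: "summable (\<lambda>k. LINT u|lborel. norm (h k u * d k))"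
  proof (rule summable_comparison_test')
    show "summable (\<lambda>k. sqrt pi * D * exp (- t * sqrt (\<Lambda> k)))"
      using L t by (intro summable_mult summable_exp_sqrt)
    fix k
    have "(LINT u|lborel. norm (h k u * d k)) = sqrt pi * exp (- t * sqrt (\<Lambda> k)) * \<bar>d k\<bar>"
      using h0 by (simp add: abs_mult int(2))
    also have "\<dots> \<le> sqrt pi * exp (- t * sqrt (\<Lambda> k)) * D" using d[of k] by (intro mult_left_mono) auto
    also have "\<dots> = sqrt pi * D * exp (- t * sqrt (\<Lambda> k))" by (simp only: mult_ac)
    finally show "norm (LINT u|lborel. norm (h k u * d k)) \<le> sqrt pi * D * exp (- t * sqrt (\<Lambda> k))"
      by (subst real_norm_def, subst abs_of_nonneg) (auto intro!: integral_nonneg_AE)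
  qed
  have "(LINT u:{0<..}|lborel. exp (- u) / sqrt u * (\<Sum>k. exp (- \<Lambda> k * (t\<^sup>2 / (4 * u))) * d k))
    = (LINT u|lborel. (\<Sum>k. h k u * d k))"
    unfolding set_lebesgue_integral_def
  proof (intro Bochner_Integration.integral_cong refl)
    fix u :: real
    show "indicator {0<..} u *\<^sub>R (exp (- u) / sqrt u * (\<Sum>k. exp (- \<Lambda> k * (t\<^sup>2 / (4 * u))) * d k)) = (\<Sum>k. h k u * d k)"
    proof (cases "u > 0")
      case True
      have "summable (\<lambda>k. D * exp (- \<Lambda> k * (t\<^sup>2 / (4 * u))))"
        using True t by (intro summable_mult sum_exp) auto
      then have "summable (\<lambda>k. exp (- \<Lambda> k * (t\<^sup>2 / (4 * u))) * d k)"
        by (rule summable_comparison_test') (use d in \<open>auto simp: abs_mult mult.commute intro!: mult_right_mono\<close>)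
      from suminf_mult[OF this, of "exp (- u) / sqrt u"] True show ?thesis
        by (simp add: h_def sq mult.assoc)
    qed (simp add: h_def)
  qed
  also have "\<dots> = (\<Sum>k. LINT u|lborel. h k u * d k)"
    by (intro integral_suminf AE_I2 summable_h summable_int integrable_mult_left int)
  also have "\<dots> = (\<Sum>k. sqrt pi * (exp (- t * sqrt (\<Lambda> k)) * d k))"
    by (simp add: int(2) mult.assoc)
  also have "\<dots> = sqrt pi * (\<Sum>k. exp (- t * sqrt (\<Lambda> k)) * d k)"
  proof (rule suminf_mult)
    have "summable (\<lambda>k. D * exp (- t * sqrt (\<Lambda> k)))"
      using L t by (intro summable_mult summable_exp_sqrt)
    then show "summable (\<lambda>k. exp (- t * sqrt (\<Lambda> k)) * d k)"
      by (rule summable_comparison_test') (use d in \<open>auto simp: abs_mult mult.commute intro!: mult_right_mono\<close>)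
  qed
  finally show ?thesis .
qed

lemma poisson_series_deriv_time:
  fixes \<Lambda> d :: "nat \<Rightarrow> real"
  assumes L: "\<And>k. real k \<le> \<Lambda> k" and d: "\<And>k. \<bar>d k\<bar> \<le> D" and t: "t > 0"
  shows "((\<lambda>s. \<Sum>k. exp (- s * sqrt (\<Lambda> k)) * d k) has_real_derivative
           (\<Sum>k. - sqrt (\<Lambda> k) * exp (- t * sqrt (\<Lambda> k)) * d k)) (at t)"
    and "summable (\<lambda>k. - sqrt (\<Lambda> k) * exp (- t * sqrt (\<Lambda> k)) * d k)"
proof -
  have L0: "0 \<le> \<Lambda> k" for k using L[of k] by linarith
  \<comment> \<open>For s > t / 2 the differentiated terms are dominated by a summable sequence
    independent of s, so their series converges uniformly around t.\<close>
  have bound: "norm (- sqrt (\<Lambda> k) * exp (- s * sqrt (\<Lambda> k)) * d k)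
      \<le> D * (sqrt (\<Lambda> k) * exp (- (t / 2) * sqrt (\<Lambda> k)))" if "s > t / 2" for s k
  proof -
    have "norm (- sqrt (\<Lambda> k) * exp (- s * sqrt (\<Lambda> k)) * d k) = \<bar>d k\<bar> * (sqrt (\<Lambda> k) * exp (- s * sqrt (\<Lambda> k)))"
      using L0[of k] by (simp add: abs_mult)
    also have "\<dots> \<le> D * (sqrt (\<Lambda> k) * exp (- (t / 2) * sqrt (\<Lambda> k)))"
      using d[of k] L0[of k] that mult_right_mono[of "t / 2" s "sqrt (\<Lambda> k)"]
      by (intro mult_mono) auto
    finally show ?thesis .
  qed
  have sm: "summable (\<lambda>k. D * (sqrt (\<Lambda> k) * exp (- (t / 2) * sqrt (\<Lambda> k))))"
    using L t by (intro summable_mult summable_sqrt_exp_sqrt) auto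
  show "summable (\<lambda>k. - sqrt (\<Lambda> k) * exp (- t * sqrt (\<Lambda> k)) * d k)"
    by (rule summable_comparison_test'[OF sm bound]) (use t in auto)
  have sd: "summable (\<lambda>k. exp (- t * sqrt (\<Lambda> k)) * d k)"
    by (rule summable_comparison_test'[OF summable_mult[OF summable_exp_sqrt[OF L t], of D]])
      (use d in \<open>auto simp: abs_mult mult.commute intro!: mult_right_mono\<close>)
  show "((\<lambda>s. \<Sum>k. exp (- s * sqrt (\<Lambda> k)) * d k) has_real_derivative
           (\<Sum>k. - sqrt (\<Lambda> k) * exp (- t * sqrt (\<Lambda> k)) * d k)) (at t)"
  proof (rule has_field_derivative_series'(2)[where S = "{t/2<..}" and ?x0.0 = t
        and f' = "\<lambda>k s. - sqrt (\<Lambda> k) * exp (- s * sqrt (\<Lambda> k)) * d k"])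
    show "uniformly_convergent_on {t / 2<..} (\<lambda>n s. \<Sum>k<n. - sqrt (\<Lambda> k) * exp (- s * sqrt (\<Lambda> k)) * d k)"
      by (rule Weierstrass_m_test'[OF bound sm]) simp
    show "((\<lambda>s. exp (- s * sqrt (\<Lambda> k)) * d k) has_real_derivative - sqrt (\<Lambda> k) * exp (- s * sqrt (\<Lambda> k)) * d k)
        (at s within {t / 2<..})" for k s
      by (auto intro!: derivative_eq_intros)
  qed (use t sd in \<open>auto simp: interior_open\<close>)
qed

text \<open>Orthogonality is derived from the injectivity of \<open>\<Lambda>\<close>; the lower
  bound \<open>real k \<le> \<Lambda> k\<close> drives the convergence of all series. The constancy
  of \<open>p 0\<close> forces \<open>\<Lambda> 0 = 0\<close> and covers the one degree on which the
  energy estimate says nothing about the size of the polynomial.\<close>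

locale eigenpolys = diffusion_weight +
  fixes p :: "nat \<Rightarrow> real poly" and \<Lambda> :: "nat \<Rightarrow> real"
  assumes ode: "W * pderiv (pderiv (p k)) + Q * pderiv (p k) + smult (\<Lambda> k) (p k) = 0"
    and Lambda_ge: "real k \<le> \<Lambda> k"
    and inj_Lambda: "inj \<Lambda>"
    and norm_p: "(LINT x|M. (poly (p k) x)\<^sup>2) = 1"
    and p0: "pderiv (p 0) = 0"
begin

lemma Lambda_nonneg: "0 \<le> \<Lambda> k"
  using Lambda_ge[of k] by linarith

lemma Lambda_0: "\<Lambda> 0 = 0"
proof -
  have "p 0 \<noteq> 0" using norm_p[of 0] by auto
  then show ?thesis using ode[of 0] p0 by simp
qed

lemma Lambda_pos: "0 < \<Lambda> k" if "k \<noteq> 0"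
  using Lambda_ge[of k] that by linarith

text \<open>The right-hand side of Green's formula is symmetric in the two polynomials, so distinct
  eigenvalues force orthogonality.\<close>

lemma integral_p_p: "(LINT x|M. poly (p j * p k) x) = (if j = k then 1 else 0)"
proof (cases "j = k")
  case True
  then show ?thesis using norm_p[of k] by (simp add: power2_eq_square)
next
  case False
  have "\<Lambda> j * (LINT x|M. poly (p j * p k) x) = \<Lambda> k * (LINT x|M. poly (p k * p j) x)"
    unfolding weak_eigen[OF ode] by (simp only: mult.commute mult.left_commute)
  then have "(\<Lambda> j - \<Lambda> k) * (LINT x|M. poly (p j * p k) x) = 0"
    by (simp only: mult.commute[of "p k"] left_diff_distrib)
  moreover have "\<Lambda> j \<noteq> \<Lambda> k" using False inj_Lambda by (auto dest: injD)
  ultimately show ?thesis using False by simp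
qed

text \<open>This is why the spatial derivative counts as much as the time derivative:
  differentiating exp(-t sqrt(\<open>\<Lambda> k\<close>)) and squaring produces the same factor
  \<open>\<Lambda> k\<close>.\<close>

lemma integral_dp_dp: "(LINT x|M. poly (W * pderiv (p j) * pderiv (p k)) x) = (if j = k then \<Lambda> k else 0)"
  using weak_eigen[OF ode[of j], of "p k"] unfolding integral_p_p[of j k] by (cases "j = k") auto

text \<open>For unit norm the energy is at most a constant times \<open>\<Lambda> k\<close>. Its
  first summand then bounds the polynomial after division by \<open>\<Lambda> k\<close>, its second
  bounds the derivative after division by the minimum of W.\<close>

lemma local_bounds:
  assumes "x \<in> I"
  shows "\<exists>\<epsilon>>0. \<exists>C\<ge>0. ball x \<epsilon> \<subseteq> I \<and>
    (\<forall>k. \<forall>y\<in>ball x \<epsilon>. \<bar>poly (p k) y\<bar> \<le> C \<and> \<bar>poly (pderiv (p k)) y\<bar> \<le> C * sqrt (\<Lambda> k))"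
proof -
  obtain \<epsilon> where e: "\<epsilon> > 0" "cball x \<epsilon> \<subseteq> I"
    using assms open_contains_cball[of I] by auto
  define c d where "c = x - \<epsilon>" and "d = x + \<epsilon>"
  have cd: "c < d" "{c..d} \<subseteq> I" using e by (auto simp: c_def d_def cball_eq_atLeastAtMost)
  obtain C where C: "C \<ge> 0" "\<And>k y. y \<in> {c..d} \<Longrightarrow>
      \<Lambda> k * (poly (p k) y)\<^sup>2 + poly W y * (poly (pderiv (p k)) y)\<^sup>2 \<le> C * \<Lambda> k"
    using energy_bound[OF cd] ode Lambda_nonneg norm_p by (metis mult.right_neutral)
  obtain z where z: "z \<in> {c..d}" "\<And>y. y \<in> {c..d} \<Longrightarrow> poly W z \<le> poly W y"
    using continuous_attains_inf[of "{c..d}" "poly W"] \<open>c < d\<close> by (fastforce intro: continuous_intros)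
  have wz: "poly W z > 0" using z(1) cd W_pos by auto
  \<comment> \<open>One summand for each of three estimates: the polynomials, their derivatives, and
    the constant polynomial of index 0, whose eigenvalue 0 cannot be divided out.\<close>
  define D where "D = sqrt C + sqrt (C / poly W z) + \<bar>poly (p 0) 0\<bar>"
  have const: "poly (p 0) y = poly (p 0) 0" for y
    using pderiv_iszero[OF p0] by auto
  have bound: "\<bar>poly (p k) y\<bar> \<le> D \<and> \<bar>poly (pderiv (p k)) y\<bar> \<le> D * sqrt (\<Lambda> k)" if y: "y \<in> {c..d}" for k y
  proof (cases "k = 0")
    case True
    have "0 \<le> sqrt C + sqrt (C / poly W z)" using C(1) wz by auto
    then show ?thesis using True const[of y] p0 Lambda_0 by (simp add: D_def)
  next
    case False
    have Wy: "poly W y > 0" using y cd W_pos by auto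
    have 1: "\<Lambda> k * (poly (p k) y)\<^sup>2 \<le> C * \<Lambda> k"
      using C(2)[OF y, of k] mult_nonneg_nonneg[OF less_imp_le[OF Wy] zero_le_power2[of "poly (pderiv (p k)) y"]]
      by linarith
    have 2: "poly W y * (poly (pderiv (p k)) y)\<^sup>2 \<le> C * \<Lambda> k"
      using C(2)[OF y, of k] mult_nonneg_nonneg[OF Lambda_nonneg[of k] zero_le_power2[of "poly (p k) y"]]
      by linarith
    have "(poly (p k) y)\<^sup>2 \<le> C" using 1 Lambda_pos[OF False] by (simp add: mult.commute)
    then have "\<bar>poly (p k) y\<bar> \<le> sqrt C" by (metis real_sqrt_abs real_sqrt_le_iff)
    moreover have "poly W z * (poly (pderiv (p k)) y)\<^sup>2 \<le> C * \<Lambda> k"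
      using 2 mult_right_mono[OF z(2)[OF y], of "(poly (pderiv (p k)) y)\<^sup>2"] by simp
    then have "(poly (pderiv (p k)) y)\<^sup>2 \<le> C / poly W z * \<Lambda> k"
      using wz by (simp add: field_simps)
    then have "\<bar>poly (pderiv (p k)) y\<bar> \<le> sqrt (C / poly W z) * sqrt (\<Lambda> k)"
      by (metis real_sqrt_abs real_sqrt_le_iff real_sqrt_mult)
    moreover have "sqrt (C / poly W z) * sqrt (\<Lambda> k) \<le> D * sqrt (\<Lambda> k)" "sqrt C \<le> D"
      using C(1) wz Lambda_nonneg[of k] by (auto simp: D_def intro!: mult_right_mono)
    ultimately show ?thesis by linarith
  qed
  have "0 \<le> D" using C(1) wz by (auto simp: D_def)
  moreover have "ball x \<epsilon> \<subseteq> {c..d}" by (auto simp: c_def d_def dist_real_def)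
  ultimately show ?thesis using e(1) bound cd(2) by (meson subset_iff)
qed

lemma pointwise_bound:
  assumes "x \<in> I"
  shows "\<exists>C\<ge>0. \<forall>k. \<bar>poly (p k) x\<bar> \<le> C"
  using local_bounds[OF assms] by force

definition T :: "real \<Rightarrow> (real \<Rightarrow> real) \<Rightarrow> real \<Rightarrow> real" where
  "T t f x = (LINT y|M. (\<Sum>k. exp (- \<Lambda> k * t) * poly (p k) x * poly (p k) y) * f y)"

definition coef :: "(real \<Rightarrow> real) \<Rightarrow> nat \<Rightarrow> real" where
  "coef f k = (LINT y|M. poly (p k) y * f y)"

lemma poly_L2: "poly r \<in> L2_space M"
proof -
  have "(\<lambda>x. (poly r x)\<^sup>2) = poly (r * r)" by (simp add: fun_eq_iff power2_eq_square)
  then show ?thesis unfolding L2_space_def using borel_measurable_M[of "poly r"] integrable_poly[of "r * r"] by simp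
qed

context
  fixes f :: "real \<Rightarrow> real"
  assumes f: "f \<in> L2_space M"
begin

lemma f_measurable: "f \<in> borel_measurable M" and f2_integrable: "integrable M (\<lambda>x. (f x)\<^sup>2)"
  using f by (auto simp: L2_space_def)

text \<open>A crude replacement for the Cauchy-Schwarz inequality. A bound on the coefficients that
  is uniform in k suffices, since the exponential factors supply the convergence.\<close>

lemma p_f_bound: "\<bar>poly r y * f y\<bar> \<le> poly (r * r) y + (f y)\<^sup>2"
proof -
  have "2 * \<bar>poly r y * f y\<bar> \<le> (poly r y)\<^sup>2 + (f y)\<^sup>2"
    using sum_squares_bound[of "\<bar>poly r y\<bar>" "\<bar>f y\<bar>"] by (simp add: abs_mult)
  then show ?thesis by (simp add: power2_eq_square)
qed

lemma integrable_p_f: "integrable M (\<lambda>y. poly r y * f y)"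
proof (rule Bochner_Integration.integrable_bound)
  show "integrable M (\<lambda>y. poly (r * r) y + (f y)\<^sup>2)"
    by (intro Bochner_Integration.integrable_add integrable_poly f2_integrable)
  show "(\<lambda>y. poly r y * f y) \<in> borel_measurable M"
    by (intro borel_measurable_times f_measurable borel_measurable_M borel_measurable_poly)
  show "AE y in M. norm (poly r y * f y) \<le> norm (poly (r * r) y + (f y)\<^sup>2)"
    by (intro AE_I2) (use p_f_bound[of r] in \<open>metis abs_ge_self order_trans real_norm_def\<close>)
qed

lemma integral_abs_p_f: "(LINT y|M. \<bar>poly (p k) y * f y\<bar>) \<le> 1 + (LINT y|M. (f y)\<^sup>2)"
proof -
  have "(LINT y|M. \<bar>poly (p k) y * f y\<bar>) \<le> (LINT y|M. poly (p k * p k) y + (f y)\<^sup>2)"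
    by (intro integral_mono p_f_bound Bochner_Integration.integrable_add integrable_poly f2_integrable
        integrable_abs integrable_p_f)
  also have "\<dots> = (LINT y|M. poly (p k * p k) y) + (LINT y|M. (f y)\<^sup>2)"
    by (intro Bochner_Integration.integral_add integrable_poly f2_integrable)
  finally show ?thesis using integral_p_p[of k k] by simp
qed

lemma coef_bound: "\<bar>coef f k\<bar> \<le> 1 + (LINT y|M. (f y)\<^sup>2)"
  unfolding coef_def using integral_abs_p_f[of k] integral_abs_bound[of M "\<lambda>y. poly (p k) y * f y"]
  by linarith

lemma semigroup_series:
  assumes "x \<in> I" "t > 0"
  shows "T t f x = (\<Sum>k. exp (- \<Lambda> k * t) * (poly (p k) x * coef f k))"
proof -
  define B where "B = 1 + (LINT y|M. (f y)\<^sup>2)"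
  have B: "B \<ge> 0" by (simp add: B_def)
  obtain C where C: "C \<ge> 0" "\<And>k. \<bar>poly (p k) x\<bar> \<le> C" using pointwise_bound[OF \<open>x \<in> I\<close>] by blast
  \<comment> \<open>The constant \<open>C'\<close> depends on y without control near the ends of the
    interval. It serves for convergence at that y alone; the exchange with the integral uses the
    uniform bound on the integrals of |p_k f|.\<close>
  have sm: "summable (\<lambda>k. norm (exp (- \<Lambda> k * t) * poly (p k) x * poly (p k) y))" if y: "y \<in> I" for y
  proof -
    obtain C' where C': "C' \<ge> 0" "\<And>k. \<bar>poly (p k) y\<bar> \<le> C'" using pointwise_bound[OF y] by blast
    have "summable (\<lambda>k. exp (- \<Lambda> k * t) * (C * C'))"
      using \<open>t > 0\<close> by (intro summable_mult2 summable_exp_mult[OF Lambda_ge])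
    then show ?thesis
      by (rule summable_comparison_test') (use C C' in \<open>auto simp: abs_mult mult.assoc intro!: mult_mono\<close>)
  qed
  have "T t f x = (LINT y|M. (\<Sum>k. exp (- \<Lambda> k * t) * poly (p k) x * (poly (p k) y * f y)))"
    unfolding T_def
  proof (intro Bochner_Integration.integral_cong refl)
    fix y assume "y \<in> space M"
    then have "summable (\<lambda>k. exp (- \<Lambda> k * t) * poly (p k) x * poly (p k) y)"
      using sm by (auto simp: space_M intro: summable_norm_cancel)
    from suminf_mult2[OF this, of "f y"]
    show "(\<Sum>k. exp (- \<Lambda> k * t) * poly (p k) x * poly (p k) y) * f y
      = (\<Sum>k. exp (- \<Lambda> k * t) * poly (p k) x * (poly (p k) y * f y))" by (simp add: mult.assoc)
  qed
  also have "\<dots> = (\<Sum>k. LINT y|M. exp (- \<Lambda> k * t) * poly (p k) x * (poly (p k) y * f y))"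
  proof (rule integral_suminf)
    show "integrable M (\<lambda>y. exp (- \<Lambda> k * t) * poly (p k) x * (poly (p k) y * f y))" for k
      by (intro integrable_mult_right integrable_p_f)
    show "AE y in M. summable (\<lambda>k. norm (exp (- \<Lambda> k * t) * poly (p k) x * (poly (p k) y * f y)))"
    proof (intro AE_I2)
      fix y assume "y \<in> space M"
      then show "summable (\<lambda>k. norm (exp (- \<Lambda> k * t) * poly (p k) x * (poly (p k) y * f y)))"
        using summable_mult2[OF sm[of y], of "norm (f y)"] by (simp add: space_M abs_mult mult.assoc)
    qed
    have "summable (\<lambda>k. exp (- \<Lambda> k * t) * (C * B))"
      using \<open>t > 0\<close> by (intro summable_mult2 summable_exp_mult[OF Lambda_ge])
    then show "summable (\<lambda>k. LINT y|M. norm (exp (- \<Lambda> k * t) * poly (p k) x * (poly (p k) y * f y)))"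
    proof (rule summable_comparison_test')
      fix k
      have "(LINT y|M. norm (exp (- \<Lambda> k * t) * poly (p k) x * (poly (p k) y * f y)))
        = exp (- \<Lambda> k * t) * (\<bar>poly (p k) x\<bar> * (LINT y|M. \<bar>poly (p k) y * f y\<bar>))"
        by (simp add: abs_mult mult.assoc)
      moreover have "exp (- \<Lambda> k * t) * (\<bar>poly (p k) x\<bar> * (LINT y|M. \<bar>poly (p k) y * f y\<bar>)) \<le> exp (- \<Lambda> k * t) * (C * B)"
        using C integral_abs_p_f[of k] by (intro mult_left_mono mult_mono) (auto simp: B_def)
      ultimately show "norm (LINT y|M. norm (exp (- \<Lambda> k * t) * poly (p k) x * (poly (p k) y * f y))) \<le> exp (- \<Lambda> k * t) * (C * B)"
        by simp
    qed
  qed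
  finally show ?thesis by (simp add: coef_def mult.assoc)
qed

lemma coef_p_bound:
  assumes "x \<in> I"
  shows "\<exists>D. \<forall>k. \<bar>poly (p k) x * coef f k\<bar> \<le> D"
proof -
  obtain C where C: "C \<ge> 0" "\<And>k. \<bar>poly (p k) x\<bar> \<le> C" using pointwise_bound[OF \<open>x \<in> I\<close>] by blast
  then have "\<bar>poly (p k) x * coef f k\<bar> \<le> C * (1 + (LINT y|M. (f y)\<^sup>2))" for k
    unfolding abs_mult using coef_bound[of k] by (intro mult_mono) auto
  then show ?thesis by blast
qed

lemma poisson_series:
  assumes "x \<in> I" "t > 0"
  shows "subordinated T t f x = (\<Sum>k. exp (- t * sqrt (\<Lambda> k)) * (poly (p k) x * coef f k))"
proof -
  obtain D where D: "\<And>k. \<bar>poly (p k) x * coef f k\<bar> \<le> D" using coef_p_bound[OF \<open>x \<in> I\<close>] by blast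
  have "(LINT u:{0<..}|lborel. exp (- u) / sqrt u * T (t\<^sup>2 / (4 * u)) f x)
    = (LINT u:{0<..}|lborel. exp (- u) / sqrt u * (\<Sum>k. exp (- \<Lambda> k * (t\<^sup>2 / (4 * u))) * (poly (p k) x * coef f k)))"
    using assms by (intro set_lebesgue_integral_cong) (auto simp: semigroup_series)
  also have "\<dots> = sqrt pi * (\<Sum>k. exp (- t * sqrt (\<Lambda> k)) * (poly (p k) x * coef f k))"
    by (rule subordinate_series[OF Lambda_ge D \<open>t > 0\<close>])
  finally show ?thesis by (simp add: subordinated_def)
qed

lemma deriv_time:
  assumes "x \<in> I" "t > 0"
  shows "deriv (\<lambda>s. subordinated T s f x) t = (\<Sum>k. - sqrt (\<Lambda> k) * exp (- t * sqrt (\<Lambda> k)) * (poly (p k) x * coef f k))"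
    and "summable (\<lambda>k. - sqrt (\<Lambda> k) * exp (- t * sqrt (\<Lambda> k)) * (poly (p k) x * coef f k))"
proof -
  obtain D where D: "\<And>k. \<bar>poly (p k) x * coef f k\<bar> \<le> D" using coef_p_bound[OF \<open>x \<in> I\<close>] by blast
  note der = poisson_series_deriv_time[OF Lambda_ge D \<open>t > 0\<close>]
  show "summable (\<lambda>k. - sqrt (\<Lambda> k) * exp (- t * sqrt (\<Lambda> k)) * (poly (p k) x * coef f k))" by (rule der(2))
  have "((\<lambda>s. subordinated T s f x) has_real_derivative
      (\<Sum>k. - sqrt (\<Lambda> k) * exp (- t * sqrt (\<Lambda> k)) * (poly (p k) x * coef f k))) (at t)"
    by (rule has_field_derivative_transform_within_open[OF der(1), of "{0<..}"])
      (use assms in \<open>auto simp: poisson_series\<close>)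
  then show "deriv (\<lambda>s. subordinated T s f x) t = (\<Sum>k. - sqrt (\<Lambda> k) * exp (- t * sqrt (\<Lambda> k)) * (poly (p k) x * coef f k))"
    by (rule DERIV_imp_deriv)
qed

text \<open>Here the bounds must hold on a whole neighbourhood of x: term-by-term differentiation
  needs uniform convergence of the differentiated series there. The growth
  sqrt(\<open>\<Lambda> k\<close>) of the derivatives is absorbed by the Poisson factor.\<close>

lemma deriv_space:
  assumes "x \<in> I" "t > 0"
  shows "deriv (\<lambda>y. subordinated T t f y) x = (\<Sum>k. exp (- t * sqrt (\<Lambda> k)) * (poly (pderiv (p k)) x * coef f k))"
    and "summable (\<lambda>k. exp (- t * sqrt (\<Lambda> k)) * (poly (pderiv (p k)) x * coef f k))"
proof -
  obtain \<epsilon> C where e: "\<epsilon> > 0" "C \<ge> 0" "ball x \<epsilon> \<subseteq> I"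
    and C: "\<And>k y. y \<in> ball x \<epsilon> \<Longrightarrow> \<bar>poly (p k) y\<bar> \<le> C \<and> \<bar>poly (pderiv (p k)) y\<bar> \<le> C * sqrt (\<Lambda> k)"
    using local_bounds[OF \<open>x \<in> I\<close>] by metis
  define B where "B = 1 + (LINT y|M. (f y)\<^sup>2)"
  have bound: "norm (exp (- t * sqrt (\<Lambda> k)) * (poly (pderiv (p k)) y * coef f k))
      \<le> C * B * (sqrt (\<Lambda> k) * exp (- t * sqrt (\<Lambda> k)))" if "y \<in> ball x \<epsilon>" for y k
  proof -
    have "norm (exp (- t * sqrt (\<Lambda> k)) * (poly (pderiv (p k)) y * coef f k))
      = exp (- t * sqrt (\<Lambda> k)) * (\<bar>poly (pderiv (p k)) y\<bar> * \<bar>coef f k\<bar>)" by (simp add: abs_mult)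
    also have "\<dots> \<le> exp (- t * sqrt (\<Lambda> k)) * ((C * sqrt (\<Lambda> k)) * B)"
      using C[OF that, of k] coef_bound[of k] e(2) Lambda_nonneg[of k] unfolding B_def
      by (intro mult_left_mono mult_mono) auto
    finally show ?thesis by (simp add: mult_ac)
  qed
  have sm: "summable (\<lambda>k. C * B * (sqrt (\<Lambda> k) * exp (- t * sqrt (\<Lambda> k))))"
    using \<open>t > 0\<close> Lambda_ge by (intro summable_mult summable_sqrt_exp_sqrt) auto
  show "summable (\<lambda>k. exp (- t * sqrt (\<Lambda> k)) * (poly (pderiv (p k)) x * coef f k))"
    by (rule summable_comparison_test'[OF sm bound]) (use e in auto)
  obtain D where D: "\<And>k. \<bar>poly (p k) x * coef f k\<bar> \<le> D" using coef_p_bound[OF \<open>x \<in> I\<close>] by blast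
  have sd: "summable (\<lambda>k. exp (- t * sqrt (\<Lambda> k)) * (poly (p k) x * coef f k))"
    by (rule summable_comparison_test'[OF summable_mult2[OF summable_exp_sqrt[OF Lambda_ge \<open>t > 0\<close>], of D]])
      (use D in \<open>auto simp: abs_mult intro!: mult_left_mono\<close>)
  have der: "((\<lambda>y. \<Sum>k. exp (- t * sqrt (\<Lambda> k)) * (poly (p k) y * coef f k)) has_real_derivative
      (\<Sum>k. exp (- t * sqrt (\<Lambda> k)) * (poly (pderiv (p k)) x * coef f k))) (at x)"
  proof (rule has_field_derivative_series'(2)[where S = "ball x \<epsilon>" and ?x0.0 = x
        and f' = "\<lambda>k y. exp (- t * sqrt (\<Lambda> k)) * (poly (pderiv (p k)) y * coef f k)"])
    show "uniformly_convergent_on (ball x \<epsilon>) (\<lambda>n y. \<Sum>k<n. exp (- t * sqrt (\<Lambda> k)) * (poly (pderiv (p k)) y * coef f k))"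
      by (rule Weierstrass_m_test'[OF bound sm])
    show "((\<lambda>y. exp (- t * sqrt (\<Lambda> k)) * (poly (p k) y * coef f k)) has_real_derivative
        exp (- t * sqrt (\<Lambda> k)) * (poly (pderiv (p k)) y * coef f k)) (at y within ball x \<epsilon>)" for k y
      by (intro DERIV_cmult DERIV_cmult_right has_field_derivative_at_within[OF poly_DERIV])
  qed (use e sd in \<open>auto simp: convex_ball\<close>)
  have "((\<lambda>y. subordinated T t f y) has_real_derivative
      (\<Sum>k. exp (- t * sqrt (\<Lambda> k)) * (poly (pderiv (p k)) x * coef f k))) (at x)"
    by (rule has_field_derivative_transform_within_open[OF der, of I])
      (use assms in \<open>auto simp: poisson_series\<close>)
  then show "deriv (\<lambda>y. subordinated T t f y) x = (\<Sum>k. exp (- t * sqrt (\<Lambda> k)) * (poly (pderiv (p k)) x * coef f k))"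
    by (rule DERIV_imp_deriv)
qed

text \<open>Expand the nonnegative integral of the square of f - q, where q is the projection of f
  to the span of the first n polynomials.\<close>

lemma bessel: "(\<Sum>k<n. (coef f k)\<^sup>2) \<le> (LINT x|M. (f x)\<^sup>2)"
proof -
  define q where "q = (\<Sum>k<n. smult (coef f k) (p k))"
  have q: "poly q x = (\<Sum>k<n. coef f k * poly (p k) x)" for x
    by (simp add: q_def poly_sum)
  have "(LINT x|M. poly (q * q) x) = (LINT x|M. (\<Sum>j<n. \<Sum>k<n. coef f j * coef f k * poly (p j * p k) x))"
    by (simp add: q sum_product mult_ac)
  also have "\<dots> = (\<Sum>j<n. \<Sum>k<n. coef f j * coef f k * (LINT x|M. poly (p j * p k) x))"
    by (subst Bochner_Integration.integral_sum;
        (subst Bochner_Integration.integral_sum)?;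
        intro Bochner_Integration.integrable_sum integrable_mult_right integrable_poly
          sum.cong refl integral_mult_right_zero)
  also have "\<dots> = (\<Sum>k<n. (coef f k)\<^sup>2)"
    by (simp only: integral_p_p) (simp add: if_distrib power2_eq_square cong: if_cong)
  finally have qq: "(LINT x|M. poly (q * q) x) = (\<Sum>k<n. (coef f k)\<^sup>2)" .
  have "(LINT x|M. poly q x * f x) = (LINT x|M. (\<Sum>k<n. coef f k * (poly (p k) x * f x)))"
    by (simp add: q sum_distrib_right mult.assoc)
  also have "\<dots> = (\<Sum>k<n. coef f k * coef f k)"
    unfolding coef_def[of f]
    by (subst Bochner_Integration.integral_sum) (auto intro!: integrable_mult_right integrable_p_f)
  finally have qf: "(LINT x|M. poly q x * f x) = (\<Sum>k<n. (coef f k)\<^sup>2)" by (simp add: power2_eq_square)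
  have "0 \<le> (LINT x|M. (f x - poly q x)\<^sup>2)" by simp
  also have "\<dots> = (LINT x|M. (f x)\<^sup>2 - 2 * (poly q x * f x) + poly (q * q) x)"
    by (simp add: power2_eq_square algebra_simps)
  also have "\<dots> = (LINT x|M. (f x)\<^sup>2) - 2 * (LINT x|M. poly q x * f x) + (LINT x|M. poly (q * q) x)"
    by (subst Bochner_Integration.integral_add, intro Bochner_Integration.integrable_diff f2_integrable integrable_mult_right integrable_p_f,
        rule integrable_poly, subst Bochner_Integration.integral_diff,
        intro f2_integrable, intro integrable_mult_right integrable_p_f, simp)
  finally show ?thesis unfolding qq qf by simp
qed

end

end

section \<open>The Littlewood--Paley function\<close>

lemma ennreal_sqrt_square: "(ennreal_sqrt x)\<^sup>2 = x"
proof (cases "x = top")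
  case False
  then show ?thesis
    by (cases x rule: ennreal_cases) (auto simp: ennreal_sqrt_def ennreal_power)
qed (simp add: ennreal_sqrt_def)

lemma ennreal_sqrt_ennreal: "0 \<le> r \<Longrightarrow> ennreal_sqrt (ennreal r) = ennreal (sqrt r)"
  by (simp add: ennreal_sqrt_def)

lemma ennreal_sqrt_mono: "x \<le> y \<Longrightarrow> ennreal_sqrt x \<le> ennreal_sqrt y"
  by (cases x rule: ennreal_cases; cases y rule: ennreal_cases)
    (auto simp: ennreal_sqrt_def top_unique)

lemma L2_norm_real_eq:
  assumes "f \<in> L2_space N"
  shows "L2_norm_real N f = ennreal (sqrt (LINT x|N. (f x)\<^sup>2))"
proof -
  have "(\<integral>\<^sup>+x. (ennreal \<bar>f x\<bar>)\<^sup>2 \<partial>N) = ennreal (LINT x|N. (f x)\<^sup>2)"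
    using assms by (subst nn_integral_eq_integral[symmetric]) (auto simp: L2_space_def ennreal_power)
  then show ?thesis by (simp add: L2_norm_def ennreal_sqrt_ennreal)
qed

context eigenpolys
begin

text \<open>The factor depending on x in the cross term of j and k when the two squared partial sums
  are multiplied out. The signs of the time derivatives cancel in the product, and what remains
  besides the coefficients is t exp(-(sqrt(\<open>\<Lambda> j\<close>) +
  sqrt(\<open>\<Lambda> k\<close>)) t).\<close>

definition pair_poly :: "nat \<Rightarrow> nat \<Rightarrow> real poly" where
  "pair_poly j k = smult (sqrt (\<Lambda> j) * sqrt (\<Lambda> k)) (p j * p k) + W * pderiv (p j) * pderiv (p k)"

text \<open>The denominators come from the integral of \<open>t exp (- t s)\<close> over \<open>t > 0\<close>, which is \<open>1 / s\<^sup>2\<close>.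
  For \<open>j = k = 0\<close> the factor \<open>pair_poly 0 0\<close> vanishes, so the junk value \<open>1 / 0 = 0\<close> is harmless.\<close>

definition square_poly :: "(real \<Rightarrow> real) \<Rightarrow> nat \<Rightarrow> real poly" where
  "square_poly f n = (\<Sum>j<n. \<Sum>k<n. smult (coef f j * coef f k / (sqrt (\<Lambda> j) + sqrt (\<Lambda> k))\<^sup>2) (pair_poly j k))"

text \<open>The integrand of the squared g-function with both series truncated. Its integral over
  positive t is a polynomial in x, hence can be integrated exactly against \<open>M\<close>.\<close>

definition partial_density :: "(real \<Rightarrow> real) \<Rightarrow> nat \<Rightarrow> real \<Rightarrow> real \<Rightarrow> real" where
  "partial_density f n t x =
     t * ((\<Sum>k<n. - sqrt (\<Lambda> k) * exp (- t * sqrt (\<Lambda> k)) * (poly (p k) x * coef f k))\<^sup>2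
        + poly W x * (\<Sum>k<n. exp (- t * sqrt (\<Lambda> k)) * (poly (pderiv (p k)) x * coef f k))\<^sup>2)"

lemma partial_density_nonneg: "0 \<le> partial_density f n t x" if "x \<in> I" "0 \<le> t"
  using W_pos[OF that(1)] that(2) by (simp add: partial_density_def)

lemma partial_density_eq:
  "partial_density f n t x = (\<Sum>j<n. \<Sum>k<n. (t * exp (- (sqrt (\<Lambda> j) + sqrt (\<Lambda> k)) * t))
      * (coef f j * coef f k * poly (pair_poly j k) x))"
proof -
  have e: "exp (- t * sqrt (\<Lambda> j)) * exp (- t * sqrt (\<Lambda> k)) = exp (- (sqrt (\<Lambda> j) + sqrt (\<Lambda> k)) * t)" for j k
    by (simp add: algebra_simps flip: exp_add)
  have sq: "t * ((\<Sum>k<n. u k)\<^sup>2 + w * (\<Sum>k<n. v k)\<^sup>2) = (\<Sum>j<n. \<Sum>k<n. t * (u j * u k + w * (v j * v k)))"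
    for u v :: "nat \<Rightarrow> real" and w :: real
    unfolding power2_eq_square sum_product by (simp add: sum_distrib_left sum.distrib distrib_left)
  have "partial_density f n t x = (\<Sum>j<n. \<Sum>k<n.
      (t * (exp (- t * sqrt (\<Lambda> j)) * exp (- t * sqrt (\<Lambda> k)))) * (coef f j * coef f k * poly (pair_poly j k) x))"
    unfolding partial_density_def sq
    by (intro sum.cong refl) (simp add: pair_poly_def algebra_simps)
  then show ?thesis by (simp only: e)
qed

lemma pair_poly_0: "pair_poly 0 0 = 0"
  by (simp add: pair_poly_def Lambda_0 p0)

lemma has_bochner_integral_partial_density:
  "has_bochner_integral lborel (\<lambda>t. indicator {0<..} t * partial_density f n t x) (poly (square_poly f n) x)"
proof -
  let ?h = "\<lambda>j k t. indicator {0<..} t *\<^sub>R ((t * exp (- (sqrt (\<Lambda> j) + sqrt (\<Lambda> k)) * t))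
      * (coef f j * coef f k * poly (pair_poly j k) x))"
  have int: "has_bochner_integral lborel (?h j k)
      (coef f j * coef f k / (sqrt (\<Lambda> j) + sqrt (\<Lambda> k))\<^sup>2 * poly (pair_poly j k) x)" for j k
  \<comment> \<open>Without its vanishing coefficient this term would require the integral of t over
    all positive t, which diverges.\<close>
  proof (cases "j = 0 \<and> k = 0")
    case True
    then show ?thesis by (simp add: pair_poly_0 has_bochner_integral_zero)
  next
    case False
    then have "0 < sqrt (\<Lambda> j) + sqrt (\<Lambda> k)"
      using Lambda_pos[of j] Lambda_pos[of k] Lambda_nonneg
      by (cases "j = 0") (auto intro: add_pos_nonneg add_nonneg_pos)
    from integral_t_exp[OF this]
    have "has_bochner_integral lborel (\<lambda>t. indicator {0<..} t *\<^sub>R (t * exp (- (sqrt (\<Lambda> j) + sqrt (\<Lambda> k)) * t)))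
       (1 / (sqrt (\<Lambda> j) + sqrt (\<Lambda> k))\<^sup>2)"
      by (simp add: has_bochner_integral_iff set_integrable_def set_lebesgue_integral_def)
    then have "has_bochner_integral lborel
       (\<lambda>t. indicator {0<..} t *\<^sub>R (t * exp (- (sqrt (\<Lambda> j) + sqrt (\<Lambda> k)) * t)) * (coef f j * coef f k * poly (pair_poly j k) x))
       (1 / (sqrt (\<Lambda> j) + sqrt (\<Lambda> k))\<^sup>2 * (coef f j * coef f k * poly (pair_poly j k) x))"
      by (rule has_bochner_integral_mult_left)
    then show ?thesis by (simp add: mult.assoc)
  qed
  have "has_bochner_integral lborel (\<lambda>t. \<Sum>j<n. \<Sum>k<n. ?h j k t) (\<Sum>j<n. \<Sum>k<n.
      (coef f j * coef f k / (sqrt (\<Lambda> j) + sqrt (\<Lambda> k))\<^sup>2 * poly (pair_poly j k) x))"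
    by (intro has_bochner_integral_sum int)
  moreover have "(\<lambda>t. \<Sum>j<n. \<Sum>k<n. ?h j k t) = (\<lambda>t. indicator {0<..} t * partial_density f n t x)"
    by (simp add: partial_density_eq sum_distrib_left)
  ultimately show ?thesis
    by (simp add: square_poly_def poly_sum)
qed

lemma nn_integral_partial_density:
  assumes "x \<in> I"
  shows "(\<integral>\<^sup>+t\<in>{0<..}. ennreal (partial_density f n t x) \<partial>lborel) = ennreal (poly (square_poly f n) x)"
proof -
  have "(\<integral>\<^sup>+t. ennreal (indicator {0<..} t * partial_density f n t x) \<partial>lborel) = ennreal (poly (square_poly f n) x)"
    using partial_density_nonneg[OF assms] has_bochner_integral_partial_density[of f n x]
    by (subst nn_integral_eq_integral) (auto simp: has_bochner_integral_iff indicator_def intro!: AE_I2)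
  moreover have "(\<integral>\<^sup>+t. ennreal (indicator {0<..} t * partial_density f n t x) \<partial>lborel)
     = (\<integral>\<^sup>+t\<in>{0<..}. ennreal (partial_density f n t x) \<partial>lborel)"
    by (intro nn_integral_cong) (simp add: indicator_def)
  ultimately show ?thesis by simp
qed

text \<open>Not visible in the double sum, whose terms may have either sign; it is inherited from
  the nonnegative density in t.\<close>

lemma square_poly_nonneg:
  assumes "x \<in> I"
  shows "0 \<le> poly (square_poly f n) x"
proof -
  have "0 \<le> (LINT t|lborel. indicator {0<..} t * partial_density f n t x)"
    by (intro integral_nonneg_AE AE_I2) (simp add: indicator_def partial_density_nonneg[OF assms])
  then show ?thesis
    using has_bochner_integral_partial_density[of f n x] by (simp add: has_bochner_integral_iff)
qed

text \<open>Orthogonality of the polynomials and of their derivatives leaves the diagonal, where 2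
  \<open>\<Lambda> k\<close> is divided by the square of 2 sqrt(\<open>\<Lambda> k\<close>): this is
  the origin of the factor 1/2.\<close>

lemma integral_square_poly:
  "(LINT x|M. poly (square_poly f n) x) = (\<Sum>k<n. if k = 0 then 0 else (coef f k)\<^sup>2 / 2)"
proof -
  have pair: "(LINT x|M. poly (pair_poly j k) x) = (if j = k then 2 * \<Lambda> k else 0)" for j k
  proof -
    have "poly (pair_poly j k) = (\<lambda>x. sqrt (\<Lambda> j) * sqrt (\<Lambda> k) * poly (p j * p k) x + poly (W * pderiv (p j) * pderiv (p k)) x)"
      by (simp add: pair_poly_def fun_eq_iff)
    then have "(LINT x|M. poly (pair_poly j k) x) = sqrt (\<Lambda> j) * sqrt (\<Lambda> k) * (LINT x|M. poly (p j * p k) x)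
      + (LINT x|M. poly (W * pderiv (p j) * pderiv (p k)) x)"
      by (simp only:)
        (subst Bochner_Integration.integral_add;
          intro integrable_mult_right integrable_poly arg_cong2[of _ _ _ _ "(+)"] integral_mult_right_zero refl)
    then show ?thesis unfolding integral_p_p integral_dp_dp using Lambda_nonneg[of k] by simp
  qed
  have "poly (square_poly f n) = (\<lambda>x. \<Sum>j<n. \<Sum>k<n. coef f j * coef f k / (sqrt (\<Lambda> j) + sqrt (\<Lambda> k))\<^sup>2 * poly (pair_poly j k) x)"
    by (simp add: square_poly_def poly_sum fun_eq_iff)
  then have "(LINT x|M. poly (square_poly f n) x)
      = (\<Sum>j<n. \<Sum>k<n. coef f j * coef f k / (sqrt (\<Lambda> j) + sqrt (\<Lambda> k))\<^sup>2 * (LINT x|M. poly (pair_poly j k) x))"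
    by (simp only:)
      (subst Bochner_Integration.integral_sum;
        (subst Bochner_Integration.integral_sum)?;
        intro Bochner_Integration.integrable_sum integrable_mult_right integrable_poly
          sum.cong refl integral_mult_right_zero)
  also have "\<dots> = (\<Sum>j<n. \<Sum>k<n. if j = k then (if k = 0 then 0 else (coef f k)\<^sup>2 / 2) else 0)"
  proof (intro sum.cong refl)
    fix j k
    show "coef f j * coef f k / (sqrt (\<Lambda> j) + sqrt (\<Lambda> k))\<^sup>2 * (LINT x|M. poly (pair_poly j k) x)
      = (if j = k then (if k = 0 then 0 else (coef f k)\<^sup>2 / 2) else 0)"
    proof (cases "j = k \<and> k \<noteq> 0")
      case True
      then have L: "0 < \<Lambda> k" using Lambda_pos by simp
      have "(sqrt (\<Lambda> k) + sqrt (\<Lambda> k))\<^sup>2 = 4 * \<Lambda> k" using L by (simp add: power2_eq_square algebra_simps)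
      then show ?thesis using True L by (simp add: pair power2_eq_square)
    qed (auto simp: pair Lambda_0)
  qed
  finally show ?thesis by simp
qed

abbreviation g :: "(real \<Rightarrow> real) \<Rightarrow> real \<Rightarrow> ennreal" where
  "g \<equiv> littlewood_paley_g (poly W) (subordinated T)"

lemma nn_integral_square_poly:
  "(\<integral>\<^sup>+x. ennreal (poly (square_poly f n) x) \<partial>M) = ennreal (\<Sum>k<n. if k = 0 then 0 else (coef f k)\<^sup>2 / 2)"
  by (subst nn_integral_eq_integral[OF integrable_poly AE_I2[OF square_poly_nonneg]])
    (simp_all only: space_M integral_square_poly)

lemma partial_density_tendsto:
  assumes "f \<in> L2_space M" "x \<in> I" "t > 0"
  shows "(\<lambda>n. partial_density f n t x) \<longlonglongrightarrow>
    t * ((deriv (\<lambda>s. subordinated T s f x) t)\<^sup>2 + poly W x * (deriv (\<lambda>y. subordinated T t f y) x)\<^sup>2)"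
  unfolding partial_density_def deriv_time(1)[OF assms] deriv_space(1)[OF assms]
  by (rule tendsto_mult[OF tendsto_const tendsto_add[OF tendsto_power[OF summable_LIMSEQ[OF deriv_time(2)[OF assms]]]
        tendsto_mult[OF tendsto_const tendsto_power[OF summable_LIMSEQ[OF deriv_space(2)[OF assms]]]]]])

text \<open>Fatou's lemma is applied twice, in t for fixed x and then in x. Between the two the
  t-integrals are replaced by the polynomials \<open>square_poly f n\<close>, so the second
  application concerns functions that are evidently measurable.\<close>

lemma nn_integral_g_le:
  assumes f: "f \<in> L2_space M"
  shows "(\<integral>\<^sup>+x. (g f x)\<^sup>2 \<partial>M) \<le> ennreal ((LINT x|M. (f x)\<^sup>2) / 2)"
proof -
  have "(\<integral>\<^sup>+x. (g f x)\<^sup>2 \<partial>M) \<le> (\<integral>\<^sup>+x. liminf (\<lambda>n. ennreal (poly (square_poly f n) x)) \<partial>M)"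
  proof (rule nn_integral_mono)
    fix x assume "x \<in> space M"
    then have x: "x \<in> I" by (simp add: space_M)
    have "(g f x)\<^sup>2 = (\<integral>\<^sup>+t\<in>{0<..}. ennreal (t * ((deriv (\<lambda>s. subordinated T s f x) t)\<^sup>2
        + poly W x * (deriv (\<lambda>y. subordinated T t f y) x)\<^sup>2)) \<partial>lborel)"
      unfolding littlewood_paley_g_def ennreal_sqrt_square ..
    also have "\<dots> = (\<integral>\<^sup>+t. liminf (\<lambda>n. ennreal (partial_density f n t x) * indicator {0<..} t) \<partial>lborel)"
    proof (intro nn_integral_cong)
      fix t :: real
      show "ennreal (t * ((deriv (\<lambda>s. subordinated T s f x) t)\<^sup>2
        + poly W x * (deriv (\<lambda>y. subordinated T t f y) x)\<^sup>2)) * indicator {0<..} t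
        = liminf (\<lambda>n. ennreal (partial_density f n t x) * indicator {0<..} t)"
      proof (cases "t > 0")
        case True
        then show ?thesis
          using tendsto_ennrealI[OF partial_density_tendsto[OF f x True]]
          by (simp add: lim_imp_Liminf)
      qed (simp add: Liminf_const)
    qed
    also have "\<dots> \<le> liminf (\<lambda>n. \<integral>\<^sup>+t\<in>{0<..}. ennreal (partial_density f n t x) \<partial>lborel)"
      by (intro nn_integral_liminf) (simp add: partial_density_def)
    finally show "(g f x)\<^sup>2 \<le> liminf (\<lambda>n. ennreal (poly (square_poly f n) x))"
      by (simp only: nn_integral_partial_density[OF x])
  qed
  also have "\<dots> \<le> liminf (\<lambda>n. \<integral>\<^sup>+x. ennreal (poly (square_poly f n) x) \<partial>M)"
    by (intro nn_integral_liminf borel_measurable_M) simp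
  also have "\<dots> \<le> ennreal ((LINT x|M. (f x)\<^sup>2) / 2)"
  proof (rule order_trans[OF Liminf_mono Liminf_le])
    have "(\<Sum>k<n. if k = 0 then 0 else (coef f k)\<^sup>2 / 2) \<le> (LINT x|M. (f x)\<^sup>2) / 2" for n
    proof -
      have "(\<Sum>k<n. if k = 0 then 0 else (coef f k)\<^sup>2 / 2) \<le> (\<Sum>k<n. (coef f k)\<^sup>2 / 2)"
        by (intro sum_mono) auto
      also have "\<dots> \<le> (LINT x|M. (f x)\<^sup>2) / 2"
        using bessel[OF f, of n] by (simp flip: sum_divide_distrib)
      finally show ?thesis .
    qed
    then show "\<forall>\<^sub>F n in sequentially. (\<integral>\<^sup>+x. ennreal (poly (square_poly f n) x) \<partial>M) \<le> ennreal ((LINT x|M. (f x)\<^sup>2) / 2)"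
      unfolding nn_integral_square_poly by (intro always_eventually allI ennreal_leI)
  qed simp_all
  finally show ?thesis .
qed

section \<open>The eigenpolynomial of index one as extremal function\<close>

lemma coef_p: "coef (poly (p j)) k = (if j = k then 1 else 0)"
  using integral_p_p[of j k] by (simp add: coef_def mult.commute)

text \<open>For this f the expansion has the single term k = 1, so the partial sums are stationary
  from n = 2 on and the inequality obtained from Fatou's lemma becomes an equality. Index 0 would
  give a vanishing g-function.\<close>

lemma nn_integral_g_p1: "(\<integral>\<^sup>+x. (g (poly (p 1)) x)\<^sup>2 \<partial>M) = ennreal (1 / 2)"
proof -
  let ?f = "poly (p 1)"
  have "(\<integral>\<^sup>+x. (g ?f x)\<^sup>2 \<partial>M) = (\<integral>\<^sup>+x. ennreal (poly (square_poly ?f 2) x) \<partial>M)"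
  proof (rule nn_integral_cong)
    fix x assume "x \<in> space M"
    then have x: "x \<in> I" by (simp add: space_M)
    have "partial_density ?f 2 t x = t * ((deriv (\<lambda>s. subordinated T s ?f x) t)\<^sup>2
        + poly W x * (deriv (\<lambda>y. subordinated T t ?f y) x)\<^sup>2)" if "t > 0" for t
    proof -
      have stab: "(\<Sum>k<n. a k * (b k * coef ?f k)) = (\<Sum>k<2. a k * (b k * coef ?f k))" if "2 \<le> n" for a b n
        by (rule sum.mono_neutral_right) (use that in \<open>auto simp: coef_p\<close>)
      have ev: "\<forall>\<^sub>F n in sequentially. partial_density ?f n t x = partial_density ?f 2 t x"
        using eventually_ge_at_top[of 2]
      proof eventually_elim
        case (elim n)
        show ?case by (simp only: partial_density_def stab[OF elim])
      qed
      show ?thesis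
        by (rule LIMSEQ_unique[OF tendsto_eventually[OF ev] partial_density_tendsto[OF poly_L2 x that]])
    qed
    then have "ennreal (t * ((deriv (\<lambda>s. subordinated T s ?f x) t)\<^sup>2
        + poly W x * (deriv (\<lambda>y. subordinated T t ?f y) x)\<^sup>2)) * indicator {0<..} t
      = ennreal (partial_density ?f 2 t x) * indicator {0<..} t" for t
      by (cases "t > 0") (simp_all only: indicator_simps greaterThan_iff mult_zero_right not_False_eq_True)
    then have "(g ?f x)\<^sup>2 = (\<integral>\<^sup>+t\<in>{0<..}. ennreal (partial_density ?f 2 t x) \<partial>lborel)"
      unfolding littlewood_paley_g_def ennreal_sqrt_square by (rule nn_integral_cong)
    also have "\<dots> = ennreal (poly (square_poly ?f 2) x)" by (rule nn_integral_partial_density[OF x])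
    finally show "(g ?f x)\<^sup>2 = ennreal (poly (square_poly ?f 2) x)" .
  qed
  also have "\<dots> = ennreal (1 / 2)"
    unfolding nn_integral_square_poly by (simp add: coef_p eval_nat_numeral)
  finally show ?thesis .
qed

lemma L2_norm_g_le:
  assumes f: "f \<in> L2_space M" and C: "sqrt (1 / 2) \<le> C"
  shows "L2_norm M (g f) \<le> ennreal C * L2_norm_real M f"
proof -
  define N where "N = (LINT x|M. (f x)\<^sup>2)"
  have N: "0 \<le> N" by (simp add: N_def)
  have "L2_norm M (g f) \<le> ennreal_sqrt (ennreal (N / 2))"
    unfolding L2_norm_def N_def by (intro ennreal_sqrt_mono nn_integral_g_le f)
  also have "\<dots> = ennreal (sqrt (1 / 2) * sqrt N)"
    using N by (simp add: ennreal_sqrt_ennreal flip: real_sqrt_mult)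
  also have "\<dots> \<le> ennreal (C * sqrt N)"
    using C N by (intro ennreal_leI mult_right_mono) auto
  also have "\<dots> = ennreal C * L2_norm_real M f"
    using order_trans[OF real_sqrt_ge_zero C] N unfolding L2_norm_real_eq[OF f] N_def[symmetric]
    by (subst ennreal_mult) auto
  finally show ?thesis .
qed

lemma L2_norm_g_bound_constant_ge:
  assumes "L2_norm M (g (poly (p 1))) \<le> ennreal C * L2_norm_real M (poly (p 1))"
  shows "sqrt (1 / 2) \<le> C"
proof -
  have "L2_norm M (g (poly (p 1))) = ennreal (sqrt (1 / 2))"
    unfolding L2_norm_def nn_integral_g_p1 by (rule ennreal_sqrt_ennreal) simp
  moreover have "L2_norm_real M (poly (p 1)) = 1"
    unfolding L2_norm_real_eq[OF poly_L2] norm_p by simp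
  ultimately have "ennreal (sqrt (1 / 2)) \<le> ennreal C" using assms by simp
  \<comment> \<open>\<open>ennreal\<close> sends negative reals to 0, so the inequality passes back
    to the reals only because its left side is positive.\<close>
  moreover have "0 < sqrt (1 / 2 :: real)" by simp
  ultimately show ?thesis by (simp only: ennreal_le_iff2) linarith
qed

end

text \<open>If the norm were 0, the energy estimate would make u vanish on a whole interval, which
  is too many roots for a nonzero polynomial. It allows the Legendre polynomials to be normalized
  without computing their norms.\<close>

lemma (in diffusion_weight) eigenpoly_norm_pos:
  assumes ode: "W * pderiv (pderiv u) + Q * pderiv u + smult l u = 0" and "l > 0" "u \<noteq> 0"
  shows "0 < (LINT x|M. (poly u x)\<^sup>2)"
proof (rule ccontr)
  assume "\<not> 0 < (LINT x|M. (poly u x)\<^sup>2)"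
  moreover have "0 \<le> (LINT x|M. (poly u x)\<^sup>2)" by (intro integral_nonneg_AE) auto
  ultimately have zero: "(LINT x|M. (poly u x)\<^sup>2) = 0" by linarith
  obtain x where "x \<in> I" using einterval_nonempty[OF a_less_b] by blast
  then obtain \<epsilon> where e: "\<epsilon> > 0" "cball x \<epsilon> \<subseteq> I"
    using open_contains_cball[of I] by auto
  have sub: "{x - \<epsilon>..x + \<epsilon>} \<subseteq> I" using e by (simp add: cball_eq_atLeastAtMost)
  have "x - \<epsilon> < x + \<epsilon>" using e(1) by simp
  from energy_bound[OF this sub] obtain C where "\<forall>u l. l \<ge> 0 \<longrightarrow>
      W * pderiv (pderiv u) + Q * pderiv u + smult l u = 0 \<longrightarrow> (\<forall>y\<in>{x - \<epsilon>..x + \<epsilon>}.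
      l * (poly u y)\<^sup>2 + poly W y * (poly (pderiv u) y)\<^sup>2 \<le> C * l * (LINT x|M. (poly u x)\<^sup>2))"
    by blast
  from this[rule_format, OF less_imp_le[OF \<open>l > 0\<close>] ode]
  have C: "l * (poly u y)\<^sup>2 + poly W y * (poly (pderiv u) y)\<^sup>2 \<le> C * l * (LINT x|M. (poly u x)\<^sup>2)"
    if "y \<in> {x - \<epsilon>..x + \<epsilon>}" for y using that .
  have "poly u y = 0" if y: "y \<in> {x - \<epsilon>..x + \<epsilon>}" for y
  proof -
    have "0 \<le> poly W y * (poly (pderiv u) y)\<^sup>2"
      using W_pos[of y] y sub by (auto simp: subset_iff)
    then have "l * (poly u y)\<^sup>2 \<le> 0" using C[OF y] zero by simp
    then show ?thesis using \<open>l > 0\<close> by (simp add: mult_le_0_iff)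
  qed
  then have "{x - \<epsilon>..x + \<epsilon>} \<subseteq> {y. poly u y = 0}" by blast
  from finite_subset[OF this poly_roots_finite[OF \<open>u \<noteq> 0\<close>]] show False
    using infinite_Icc[OF \<open>x - \<epsilon> < x + \<epsilon>\<close>] by blast
qed

section \<open>Reduction of the conditions on a weight to monomials\<close>

lemma set_integrable_poly_mult:
  fixes \<rho> :: "real \<Rightarrow> real"
  assumes "\<And>i. set_integrable N A (\<lambda>x. x ^ i * \<rho> x)"
  shows "set_integrable N A (\<lambda>x. poly r x * \<rho> x)"
proof -
  have "set_integrable N A (\<lambda>x. \<Sum>i\<le>degree r. coeff r i * (x ^ i * \<rho> x))"
    unfolding set_integrable_def scaleR_sum_right
    by (intro Bochner_Integration.integrable_sum set_integrable_mult_right[unfolded set_integrable_def]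
        assms[unfolded set_integrable_def])
  then show ?thesis by (simp add: poly_altdef sum_distrib_right mult.assoc)
qed

lemma tendsto_poly_mult_zero:
  fixes h :: "real \<Rightarrow> real"
  assumes "\<And>i. ((\<lambda>x. x ^ i * h x) \<longlongrightarrow> 0) F"
  shows "((\<lambda>x. poly r x * h x) \<longlongrightarrow> 0) F"
proof -
  have "((\<lambda>x. \<Sum>i\<le>degree r. coeff r i * (x ^ i * h x)) \<longlongrightarrow> 0) F"
    by (intro tendsto_null_sum tendsto_mult_right_zero assms)
  then show ?thesis by (simp add: poly_altdef sum_distrib_right mult.assoc)
qed

section \<open>Hermite polynomials\<close>

definition hermite :: "nat \<Rightarrow> real poly" where
  "hermite k = (\<Sum>j\<le>k div 2. monom (fact k * ((-1) ^ j * 2 ^ (k - 2 * j) / (fact j * fact (k - 2 * j)))) (k - 2 * j))"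

lemma poly_hermite: "poly (hermite k) x = hermite_poly k x"
  by (simp add: hermite_def hermite_poly_def poly_sum poly_monom sum_distrib_left power_mult_distrib mult.assoc)

lemma coeff_hermite:
  "coeff (hermite k) m = (if m \<le> k \<and> even (k - m)
     then fact k * ((-1) ^ ((k - m) div 2) * 2 ^ m / (fact ((k - m) div 2) * fact m)) else 0)"
proof (cases "m \<le> k \<and> even (k - m)")
  case True
  then obtain i where i: "k = m + 2 * i" by (metis evenE le_add_diff_inverse)
  have "coeff (hermite k) m = (\<Sum>j\<le>k div 2. if j = i
      then fact k * ((-1) ^ j * 2 ^ (k - 2 * j) / (fact j * fact (k - 2 * j))) else 0)"
    unfolding hermite_def coeff_sum coeff_monom by (intro sum.cong refl) (use i in auto)
  then show ?thesis using i by simp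
next
  case False
  then have "coeff (hermite k) m = (\<Sum>j\<le>k div 2. 0)"
    unfolding hermite_def coeff_sum coeff_monom by (intro sum.cong refl) auto
  then show ?thesis using False by simp
qed

lemma pderiv_hermite_Suc: "pderiv (hermite (Suc k)) = smult (2 * real (Suc k)) (hermite k)"
proof (rule poly_eqI)
  fix m
  show "coeff (pderiv (hermite (Suc k))) m = coeff (smult (2 * real (Suc k)) (hermite k)) m"
    by (auto simp: coeff_pderiv coeff_hermite field_simps simp del: of_nat_Suc)
qed

text \<open>Half of the classical Hermite equation, so that the eigenvalue is k and W is the
  coefficient 1/2 of \<open>gauss_g\<close>. Comparing coefficients leaves a two-term recurrence
  between the degrees m and m + 2.\<close>

lemma hermite_ode:
  "[:1 / 2:] * pderiv (pderiv (hermite k)) + [:0, - 1:] * pderiv (hermite k) + smult (real k) (hermite k) = 0"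
proof (rule poly_eqI)
  fix m
  have "coeff ([:1 / 2:] * pderiv (pderiv (hermite k)) + [:0, - 1:] * pderiv (hermite k) + smult (real k) (hermite k)) m
    = (real m + 1) * (real m + 2) / 2 * coeff (hermite k) (Suc (Suc m)) + (real k - real m) * coeff (hermite k) m"
    by (cases m) (simp_all add: coeff_pderiv algebra_simps)
  also have "\<dots> = 0"
  proof (cases "Suc (Suc m) \<le> k \<and> even (k - m)")
    case True
    then obtain i where "k - m = 2 * i" using evenE by blast
    with True have i: "k = m + 2 * i" by simp
    with True obtain n where n: "i = Suc n" by (cases i) auto
    define A where "A = fact k * ((-1) ^ n * 2 ^ m / (fact n * fact m) :: real)"
    have "coeff (hermite k) (Suc (Suc m)) = fact k * ((-1) ^ n * 2 ^ Suc (Suc m) / (fact n * fact (Suc (Suc m))))"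
      and "coeff (hermite k) m = fact k * ((-1) ^ Suc n * 2 ^ m / (fact (Suc n) * fact m))"
      by (simp_all add: coeff_hermite i n del: power_Suc fact_Suc)
    moreover have "(fact (Suc (Suc m)) :: real) = (real m + 2) * ((real m + 1) * fact m)"
      "(fact (Suc n) :: real) = (real n + 1) * fact n"
      by (simp_all add: algebra_simps)
    moreover have "real m + 2 \<noteq> 0" "real m + 1 \<noteq> 0" "real n + 1 \<noteq> 0"
      by simp_all
    ultimately have "coeff (hermite k) (Suc (Suc m)) = 4 * A / ((real m + 1) * (real m + 2))"
      and "coeff (hermite k) m = - A / (real n + 1)"
      by (simp_all add: A_def mult_ac)
    then have e1: "(real m + 1) * (real m + 2) / 2 * coeff (hermite k) (Suc (Suc m)) = 2 * A"
      and e2: "(real n + 1) * coeff (hermite k) m = - A"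
      using \<open>real m + 2 \<noteq> 0\<close> \<open>real m + 1 \<noteq> 0\<close> \<open>real n + 1 \<noteq> 0\<close> by simp_all
    have "real k - real m = 2 * (real n + 1)" by (simp add: i n)
    then have "(real k - real m) * coeff (hermite k) m = 2 * ((real n + 1) * coeff (hermite k) m)"
      by (simp only: mult.assoc)
    then show ?thesis unfolding e1 e2 by linarith
  next
    case False
    then have "coeff (hermite k) (Suc (Suc m)) = 0" by (auto simp: coeff_hermite)
    \<comment> \<open>At m = k the factor k - m vanishes; in all remaining cases the coefficient is
      0 by degree or by parity.\<close>
    moreover have "m = k \<or> coeff (hermite k) m = 0"
      using False by (cases "k = Suc m") (auto simp: coeff_hermite)
    ultimately show ?thesis by auto
  qed
  finally show "coeff ([:1 / 2:] * pderiv (pderiv (hermite k)) + [:0, - 1:] * pderiv (hermite k) + smult (real k) (hermite k)) m = coeff 0 m"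
    by simp
qed

lemma gauss_density_eq: "normal_density 0 (sqrt (1 / 2)) x = exp (- x\<^sup>2) / sqrt pi"
  by (simp add: normal_density_def)

lemma integrable_power_gauss: "integrable lborel (\<lambda>x::real. x ^ i * (exp (- x\<^sup>2) / sqrt pi))"
proof -
  have "integrable lborel (\<lambda>x::real. normal_density 0 (sqrt (1 / 2)) x * (x - 0) ^ i)"
  proof (cases "even i")
    case True
    then obtain k where "i = 2 * k" by blast
    then show ?thesis
      using normal_moment_even[where \<mu> = 0 and \<sigma> = "sqrt (1 / 2)" and k = k] by (simp add: has_bochner_integral_iff)
  next
    case False
    then obtain k where "i = 2 * k + 1" by (auto elim: oddE)
    then show ?thesis
      using normal_moment_odd[where \<mu> = 0 and \<sigma> = "sqrt (1 / 2)" and k = k] by (simp add: has_bochner_integral_iff)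
  qed
  then show ?thesis by (simp add: gauss_density_eq mult.commute)
qed

lemma tendsto_power_gauss:
  "((\<lambda>x::real. x ^ i * exp (- x\<^sup>2)) \<longlongrightarrow> 0) at_top"
  "((\<lambda>x::real. x ^ i * exp (- x\<^sup>2)) \<longlongrightarrow> 0) at_bot"
proof -
  show top: "((\<lambda>x::real. x ^ i * exp (- x\<^sup>2)) \<longlongrightarrow> 0) at_top"
    by real_asymp
  have "((\<lambda>x::real. (- 1) ^ i * (x ^ i * exp (- x\<^sup>2))) \<longlongrightarrow> 0) at_top"
    by (rule tendsto_mult_right_zero[OF top])
  moreover have "(- x) ^ i * exp (- (- x)\<^sup>2) = (- 1) ^ i * (x ^ i * exp (- x\<^sup>2))" for x :: real
    by (subst power_minus) simp
  ultimately show "((\<lambda>x::real. x ^ i * exp (- x\<^sup>2)) \<longlongrightarrow> 0) at_bot"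
    unfolding filterlim_at_bot_mirror by (simp only:)
qed

interpretation hermite: diffusion_weight "- \<infinity>" "\<infinity>" "\<lambda>x. exp (- x\<^sup>2) / sqrt pi" "[:1 / 2:]" "[:0, - 1:]"
proof
  show "((\<lambda>x. poly [:1 / 2:] x * (exp (- x\<^sup>2) / sqrt pi)) has_real_derivative poly [:0, - 1:] x * (exp (- x\<^sup>2) / sqrt pi)) (at x)" for x
  proof -
    have "((\<lambda>x. 1 / (2 * sqrt pi) * exp (- x\<^sup>2)) has_real_derivative
        1 / (2 * sqrt pi) * (exp (- x\<^sup>2) * - (2 * x ^ (2 - 1) * 1))) (at x)"
      by (intro DERIV_cmult DERIV_chain2[OF DERIV_exp] DERIV_minus) (rule derivative_eq_intros refl | simp)+
    then show ?thesis by (simp add: mult_ac)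
  qed
  show "set_integrable lborel (einterval (- \<infinity>) \<infinity>) (\<lambda>x. poly r x * (exp (- x\<^sup>2) / sqrt pi))" for r
    by (rule set_integrable_poly_mult) (use integrable_power_gauss in \<open>simp add: set_integrable_def\<close>)
  have *: "((\<lambda>x. x ^ i * (poly [:1 / 2:] x * (exp (- x\<^sup>2) / sqrt pi))) \<longlongrightarrow> 0) F"
    if "((\<lambda>x::real. x ^ i * exp (- x\<^sup>2)) \<longlongrightarrow> 0) F" for i F
    using tendsto_mult_right_zero[OF that, of "1 / (2 * sqrt pi)"] by simp
  show "(((\<lambda>x. poly r x * (poly [:1 / 2:] x * (exp (- x\<^sup>2) / sqrt pi))) \<circ> real_of_ereal) \<longlongrightarrow> 0) (at_right (- \<infinity>))" for r
    unfolding ereal_tendsto_simps by (intro tendsto_poly_mult_zero * tendsto_power_gauss)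
  show "(((\<lambda>x. poly r x * (poly [:1 / 2:] x * (exp (- x\<^sup>2) / sqrt pi))) \<circ> real_of_ereal) \<longlongrightarrow> 0) (at_left \<infinity>)" for r
    unfolding ereal_tendsto_simps by (intro tendsto_poly_mult_zero * tendsto_power_gauss)
qed auto

lemma hermite_measure: "hermite.M = gauss_measure"
proof -
  have "restrict_space lborel UNIV = (lborel :: real measure)"
    by (rule measure_eqI) (simp_all add: sets_restrict_space emeasure_restrict_space)
  then show ?thesis by (simp add: hermite.M_def gauss_measure_def)
qed

text \<open>Green's formula and H_{k+1}' = 2 (k + 1) H_k express the norm in degree k + 1 through
  the norm in degree k. The value is needed explicitly because it stands in the kernel of
  \<open>hermite_semigroup\<close>.\<close>

lemma integral_hermite_square: "(LINT x|hermite.M. poly (hermite k * hermite k) x) = 2 ^ k * fact k"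
proof (induction k)
  case 0
  have "(LINT x|hermite.M. poly (hermite 0 * hermite 0) x) = (LINT x|lborel. exp (- x\<^sup>2) / sqrt pi)"
    by (subst hermite.integral_M) (simp_all add: hermite_def set_lebesgue_integral_def one_pCons)
  also have "\<dots> = 1"
    unfolding gauss_density_eq[symmetric] by (rule integral_normal_density) simp
  finally show ?case by (simp only: power_0 fact_0 mult_1)
next
  case (Suc k)
  have "real (Suc k) * (LINT x|hermite.M. poly (hermite (Suc k) * hermite (Suc k)) x)
    = (LINT x|hermite.M. poly ([:1 / 2:] * pderiv (hermite (Suc k)) * pderiv (hermite (Suc k))) x)"
    by (rule hermite.weak_eigen[OF hermite_ode])
  also have "\<dots> = (LINT x|hermite.M. 2 * (real (Suc k))\<^sup>2 * poly (hermite k * hermite k) x)"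
    by (simp add: pderiv_hermite_Suc power2_eq_square mult_ac del: of_nat_Suc)
  also have "\<dots> = 2 * (real (Suc k))\<^sup>2 * (2 ^ k * fact k)"
    by (simp only: integral_mult_right_zero Suc)
  finally show ?case by (simp add: power2_eq_square field_simps del: of_nat_Suc)
qed

section \<open>Laguerre polynomials\<close>

definition laguerre :: "real \<Rightarrow> nat \<Rightarrow> real poly" where
  "laguerre \<alpha> k = (\<Sum>j\<le>k. monom (((real k + \<alpha>) gchoose (k - j)) * ((-1) ^ j / fact j)) j)"

lemma poly_laguerre: "poly (laguerre \<alpha> k) x = laguerre_poly \<alpha> k x"
  by (simp add: laguerre_def laguerre_poly_def poly_sum poly_monom power_minus[of x] mult.assoc)

lemma coeff_laguerre:
  "coeff (laguerre \<alpha> k) m = (if m \<le> k then ((real k + \<alpha>) gchoose (k - m)) * ((-1) ^ m / fact m) else 0)"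
  by (simp add: laguerre_def coeff_sum)

lemma pderiv_laguerre_Suc: "pderiv (laguerre \<alpha> (Suc k)) = - laguerre (\<alpha> + 1) k"
proof (rule poly_eqI)
  fix m
  have eq: "real (Suc k) + \<alpha> = real k + (\<alpha> + 1)" by simp
  show "coeff (pderiv (laguerre \<alpha> (Suc k))) m = coeff (- laguerre (\<alpha> + 1) k) m"
    unfolding coeff_pderiv coeff_minus coeff_laguerre eq by (auto simp: field_simps simp del: of_nat_Suc)
qed

text \<open>Comparing coefficients leaves a recurrence between the degrees m and m + 1, which
  reduces to the identity \<open>gbinomial_mult_1\<close> with lower index n = k - m - 1.\<close>

lemma laguerre_ode:
  "[:0, 1:] * pderiv (pderiv (laguerre \<alpha> k)) + [:\<alpha> + 1, - 1:] * pderiv (laguerre \<alpha> k) + smult (real k) (laguerre \<alpha> k) = 0"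
proof (rule poly_eqI)
  fix m
  have "coeff ([:0, 1:] * pderiv (pderiv (laguerre \<alpha> k)) + [:\<alpha> + 1, - 1:] * pderiv (laguerre \<alpha> k) + smult (real k) (laguerre \<alpha> k)) m
    = (real m + 1) * (real m + \<alpha> + 1) * coeff (laguerre \<alpha> k) (Suc m) + (real k - real m) * coeff (laguerre \<alpha> k) m"
    by (cases m) (simp_all add: coeff_pderiv algebra_simps)
  also have "\<dots> = 0"
  proof (cases "m < k")
    case True
    then obtain n where n: "k = Suc (m + n)" by (metis less_imp_Suc_add)
    have c: "(real m + 1) * coeff (laguerre \<alpha> k) (Suc m) = - ((real k + \<alpha>) gchoose n) * ((-1) ^ m / fact m)"
      "coeff (laguerre \<alpha> k) m = ((real k + \<alpha>) gchoose Suc n) * ((-1) ^ m / fact m)"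
      using True by (simp_all add: coeff_laguerre n Suc_diff_le add.commute[of "real m"])
    have "(real k + \<alpha>) * ((real k + \<alpha>) gchoose n)
      = real n * ((real k + \<alpha>) gchoose n) + real (Suc n) * ((real k + \<alpha>) gchoose Suc n)"
      by (rule gbinomial_mult_1)
    then have "(real m + \<alpha> + 1) * ((real k + \<alpha>) gchoose n) = (real k - real m) * ((real k + \<alpha>) gchoose Suc n)"
      by (simp add: n algebra_simps)
    then have "(real k - real m) * coeff (laguerre \<alpha> k) m
      = ((real m + \<alpha> + 1) * ((real k + \<alpha>) gchoose n)) * ((-1) ^ m / fact m)"
      by (simp add: c(2))
    moreover have "(real m + 1) * (real m + \<alpha> + 1) * coeff (laguerre \<alpha> k) (Suc m)
      = (real m + \<alpha> + 1) * ((real m + 1) * coeff (laguerre \<alpha> k) (Suc m))"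
      by (simp only: mult_ac)
    then have "(real m + 1) * (real m + \<alpha> + 1) * coeff (laguerre \<alpha> k) (Suc m)
      = - (((real m + \<alpha> + 1) * ((real k + \<alpha>) gchoose n)) * ((-1) ^ m / fact m))"
      unfolding c(1) by simp
    ultimately show ?thesis by simp
  qed (auto simp: coeff_laguerre)
  finally show "coeff ([:0, 1:] * pderiv (pderiv (laguerre \<alpha> k)) + [:\<alpha> + 1, - 1:] * pderiv (laguerre \<alpha> k) + smult (real k) (laguerre \<alpha> k)) m = coeff 0 m"
    by simp
qed

abbreviation laguerre_density :: "real \<Rightarrow> real \<Rightarrow> real" where
  "laguerre_density \<alpha> x \<equiv> x powr \<alpha> * exp (- x) / Gamma (\<alpha> + 1)"

lemma has_bochner_integral_Gamma:
  fixes \<alpha> :: real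
  assumes "\<alpha> > - 1"
  shows "has_bochner_integral lborel (\<lambda>x. indicator {0<..} x * (x powr \<alpha> * exp (- x))) (Gamma (\<alpha> + 1))"
proof (rule has_bochner_integral_nn_integral)
  have "ennreal (Gamma (\<alpha> + 1)) = (\<integral>\<^sup>+x. ennreal (indicator {0..} x * x powr (\<alpha> + 1 - 1) / exp x) \<partial>lborel)"
    using Gamma_conv_nn_integral_real[of "\<alpha> + 1"] assms by simp
  also have "\<dots> = (\<integral>\<^sup>+x. ennreal (indicator {0<..} x * (x powr \<alpha> * exp (- x))) \<partial>lborel)"
    by (intro nn_integral_cong) (auto simp: indicator_def exp_minus field_simps)
  finally show "(\<integral>\<^sup>+x. ennreal (indicator {0<..} x * (x powr \<alpha> * exp (- x))) \<partial>lborel) = ennreal (Gamma (\<alpha> + 1))" ..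
  show "0 \<le> Gamma (\<alpha> + 1)" using assms by (intro less_imp_le Gamma_real_pos) simp
qed auto

text \<open>The condition \<alpha> > -1 acts twice at the endpoint 0: it makes x^\<alpha> integrable
  and it makes W \<rho>, which is of order x^(\<alpha> + 1), tend to 0. The moments are Gamma
  integrals with shifted parameter.\<close>

lemma laguerre_weight:
  assumes \<alpha>: "\<alpha> > - 1"
  shows "diffusion_weight 0 \<infinity> (laguerre_density \<alpha>) [:0, 1:] [:\<alpha> + 1, - 1:]"
proof
  have int: "einterval 0 \<infinity> = {0<..}" by (simp add: zero_ereal_def)
  have G: "0 < Gamma (\<alpha> + 1)" using \<alpha> by (intro Gamma_real_pos) simp
  show "0 < laguerre_density \<alpha> x" "0 < poly [:0, 1:] x" if "x \<in> einterval 0 \<infinity>" for x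
    using that G by (auto simp: int)
  show "((\<lambda>x. poly [:0, 1:] x * laguerre_density \<alpha> x) has_real_derivative
      poly [:\<alpha> + 1, - 1:] x * laguerre_density \<alpha> x) (at x)" if "x \<in> einterval 0 \<infinity>" for x
  proof -
    have x: "x > 0" using that by (simp add: int)
    have "((\<lambda>x. x powr (\<alpha> + 1) * exp (- x) / Gamma (\<alpha> + 1)) has_real_derivative
        (x powr (\<alpha> + 1) * (exp (- x) * - 1) + (\<alpha> + 1) * x powr (\<alpha> + 1 - 1) * exp (- x)) / Gamma (\<alpha> + 1)) (at x)"
      by (intro DERIV_cdivide DERIV_mult' has_real_derivative_powr x DERIV_chain2[OF DERIV_exp] DERIV_minus DERIV_ident)
    also have "(x powr (\<alpha> + 1) * (exp (- x) * - 1) + (\<alpha> + 1) * x powr (\<alpha> + 1 - 1) * exp (- x)) / Gamma (\<alpha> + 1)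
        = poly [:\<alpha> + 1, - 1:] x * laguerre_density \<alpha> x"
      using x G by (simp add: powr_add field_simps)
    finally show ?thesis
      by (rule has_field_derivative_transform_within_open[of _ _ _ "{0<..}"])
        (use x in \<open>auto simp: powr_add\<close>)
  qed
  show "set_integrable lborel (einterval 0 \<infinity>) (\<lambda>x. poly r x * laguerre_density \<alpha> x)" for r
  proof (rule set_integrable_poly_mult)
    fix i
    have "integrable lborel (\<lambda>x. indicator {0<..} x * (x powr (real i + \<alpha>) * exp (- x)))"
      using has_bochner_integral_Gamma[of "real i + \<alpha>"] \<alpha> by (simp add: has_bochner_integral_iff)
    then have "integrable lborel (\<lambda>x. indicator {0<..} x * (x powr (real i + \<alpha>) * exp (- x)) * (1 / Gamma (\<alpha> + 1)))"
      by (rule integrable_mult_left)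
    then show "set_integrable lborel (einterval 0 \<infinity>) (\<lambda>x. x ^ i * laguerre_density \<alpha> x)"
      unfolding int set_integrable_def
      by (rule Bochner_Integration.integrable_cong[THEN iffD1, rotated -1])
        (auto simp: indicator_def powr_add powr_realpow)
  qed
  have lim: "(((\<lambda>x. poly r x * (poly [:0, 1:] x * laguerre_density \<alpha> x))) \<longlongrightarrow> 0) F"
    if "\<And>i. ((\<lambda>x. x powr (real i + \<alpha> + 1) * exp (- x)) \<longlongrightarrow> 0) F" "\<forall>\<^sub>F x in F. x > 0" for r F
  proof (rule tendsto_poly_mult_zero)
    fix i
    have "\<forall>\<^sub>F x in F. 1 / Gamma (\<alpha> + 1) * (x powr (real i + \<alpha> + 1) * exp (- x)) = x ^ i * (poly [:0, 1:] x * laguerre_density \<alpha> x)"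
      using that(2) by eventually_elim (simp add: powr_add powr_realpow)
    from Lim_transform_eventually[OF tendsto_mult_right_zero[OF that(1)] this]
    show "((\<lambda>x. x ^ i * (poly [:0, 1:] x * laguerre_density \<alpha> x)) \<longlongrightarrow> 0) F" .
  qed
  show "(((\<lambda>x. poly r x * (poly [:0, 1:] x * laguerre_density \<alpha> x)) \<circ> real_of_ereal) \<longlongrightarrow> 0) (at_right 0)" for r
  proof -
    have "((\<lambda>x::real. x powr (real i + \<alpha> + 1) * exp (- x)) \<longlongrightarrow> 0) (at_right 0)" for i
    proof -
      have "real i + \<alpha> + 1 > 0" using \<alpha> by simp
      then show ?thesis by real_asymp
    qed
    then show ?thesis
      unfolding zero_ereal_def ereal_tendsto_simps
      by (intro lim) (auto simp: eventually_at_right_less)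
  qed
  show "(((\<lambda>x. poly r x * (poly [:0, 1:] x * laguerre_density \<alpha> x)) \<circ> real_of_ereal) \<longlongrightarrow> 0) (at_left \<infinity>)" for r
    unfolding ereal_tendsto_simps
  proof (rule lim)
    show "((\<lambda>x::real. x powr (real i + \<alpha> + 1) * exp (- x)) \<longlongrightarrow> 0) at_top" for i
      by real_asymp
  qed (rule eventually_gt_at_top)
qed simp

lemma laguerre_measure_eq: "diffusion_weight.M 0 \<infinity> (laguerre_density \<alpha>) = laguerre_measure \<alpha>" if "\<alpha> > - 1"
  unfolding diffusion_weight.M_def[OF laguerre_weight[OF that]] laguerre_measure_def by (simp add: zero_ereal_def)

text \<open>Differentiation lowers the degree and raises \<alpha> by one, hence the induction over k
  for all \<alpha> together. The factor W = x in Green's formula raises the exponent of the weight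
  to match, at the cost of the quotient of the two Gamma normalizations.\<close>

lemma integral_laguerre_square:
  assumes "\<alpha> > - 1"
  shows "(LINT x|laguerre_measure \<alpha>. poly (laguerre \<alpha> k * laguerre \<alpha> k) x)
    = Gamma (real k + \<alpha> + 1) / (Gamma (\<alpha> + 1) * fact k)"
  using assms
proof (induction k arbitrary: \<alpha>)
  case 0
  interpret diffusion_weight 0 \<infinity> "laguerre_density \<alpha>" "[:0, 1:]" "[:\<alpha> + 1, - 1:]"
    by (rule laguerre_weight[OF 0])
  have "(LINT x|M. poly (laguerre \<alpha> 0 * laguerre \<alpha> 0) x)
    = (LINT x|lborel. indicator {0<..} x * (x powr \<alpha> * exp (- x)) * (1 / Gamma (\<alpha> + 1)))"
    by (subst integral_M) (simp_all add: laguerre_def set_lebesgue_integral_def zero_ereal_def one_pCons)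
  also have "\<dots> = Gamma (\<alpha> + 1) * (1 / Gamma (\<alpha> + 1))"
    by (intro has_bochner_integral_integral_eq has_bochner_integral_mult_left has_bochner_integral_Gamma 0)
  finally show ?case by (simp add: laguerre_measure_eq[OF 0])
next
  case (Suc k)
  have a1: "\<alpha> + 1 > - 1" using Suc.prems by simp
  have G: "0 < Gamma (\<alpha> + 1)" "0 < Gamma (\<alpha> + 1 + 1)" using Suc.prems by (intro Gamma_real_pos; simp)+
  interpret A: diffusion_weight 0 \<infinity> "laguerre_density \<alpha>" "[:0, 1:]" "[:\<alpha> + 1, - 1:]"
    by (rule laguerre_weight[OF Suc.prems])
  interpret B: diffusion_weight 0 \<infinity> "laguerre_density (\<alpha> + 1)" "[:0, 1:]" "[:\<alpha> + 1 + 1, - 1:]"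
    by (rule laguerre_weight[OF a1])
  let ?q = "laguerre (\<alpha> + 1) k * laguerre (\<alpha> + 1) k"
  have "real (Suc k) * (LINT x|A.M. poly (laguerre \<alpha> (Suc k) * laguerre \<alpha> (Suc k)) x)
    = (LINT x|A.M. poly ([:0, 1:] * pderiv (laguerre \<alpha> (Suc k)) * pderiv (laguerre \<alpha> (Suc k))) x)"
    by (rule A.weak_eigen[OF laguerre_ode])
  also have "\<dots> = (LINT x|A.M. poly ([:0, 1:] * ?q) x)"
    by (simp add: pderiv_laguerre_Suc)
  also have "\<dots> = (LINT x:{0<..}|lborel. poly ([:0, 1:] * ?q) x * laguerre_density \<alpha> x)"
    by (subst A.integral_M) (simp_all add: zero_ereal_def del: poly_mult)
  also have "\<dots> = (LINT x:{0<..}|lborel. (Gamma (\<alpha> + 1 + 1) / Gamma (\<alpha> + 1)) * (poly ?q x * laguerre_density (\<alpha> + 1) x))"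
    by (intro set_lebesgue_integral_cong) (use G in \<open>auto simp: powr_add\<close>)
  also have "\<dots> = (Gamma (\<alpha> + 1 + 1) / Gamma (\<alpha> + 1)) * (LINT x|B.M. poly ?q x)"
    by (subst B.integral_M) (simp_all add: zero_ereal_def del: poly_mult)
  also have "\<dots> = Gamma (real k + (\<alpha> + 1) + 1) / (Gamma (\<alpha> + 1) * fact k)"
    unfolding laguerre_measure_eq[OF a1] Suc.IH[OF a1] using G by simp
  also have "real k + (\<alpha> + 1) + 1 = real (Suc k) + \<alpha> + 1" by simp
  finally have "real (Suc k) * (LINT x|laguerre_measure \<alpha>. poly (laguerre \<alpha> (Suc k) * laguerre \<alpha> (Suc k)) x)
      = Gamma (real (Suc k) + \<alpha> + 1) / (Gamma (\<alpha> + 1) * fact k)"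
    unfolding laguerre_measure_eq[OF Suc.prems] .
  then show ?case using G by (simp add: field_simps del: poly_mult of_nat_Suc)
qed

section \<open>Legendre polynomials\<close>

text \<open>The Legendre operator has simple coefficients in these linear factors: 1 - x^2 = -4 U V
  and -2 x = -2 (U + V).\<close>

abbreviation (input) U :: "real poly" where "U \<equiv> [:- (1 / 2), 1 / 2:]"
abbreviation (input) V :: "real poly" where "V \<equiv> [:1 / 2, 1 / 2:]"

definition legendre :: "nat \<Rightarrow> real poly" where
  "legendre k = (\<Sum>j\<le>k. smult ((real (k choose j))\<^sup>2) (U ^ j * V ^ (k - j)))"

lemma poly_legendre: "poly (legendre k) x = jacobi_poly 0 0 k x"
proof -
  have "((real k + 0) gchoose (k - j)) * ((real k + 0) gchoose j) = (real (k choose j))\<^sup>2" if "j \<le> k" for j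
    using binomial_symmetric[OF that] by (simp add: power2_eq_square flip: binomial_gbinomial)
  then show ?thesis
    by (simp add: legendre_def jacobi_poly_def poly_sum poly_power mult.assoc diff_divide_distrib add_divide_distrib add_ac)
qed

lemma pderiv_U_V:
  "pderiv (U ^ i * V ^ n) = smult (real i / 2) (U ^ (i - 1) * V ^ n) + smult (real n / 2) (U ^ i * V ^ (n - 1))"
proof -
  have "poly (pderiv (U ^ i * V ^ n)) x
      = poly (smult (real i / 2) (U ^ (i - 1) * V ^ n) + smult (real n / 2) (U ^ i * V ^ (n - 1))) x" for x
    by (simp add: pderiv_mult pderiv_power pderiv_pCons mult_ac)
  then show ?thesis by (metis poly_eq_poly_eq_iff ext)
qed

text \<open>The operator keeps the total degree j + m in U and V and moves only to the two
  neighbouring products, so the differential equation becomes a comparison of coefficients along a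
  fixed total degree.\<close>

lemma legendre_operator_term:
  "[:1, 0, - 1:] * pderiv (pderiv (U ^ j * V ^ m)) + [:0, - 2:] * pderiv (U ^ j * V ^ m)
   = - (smult ((real j)\<^sup>2) (U ^ (j - 1) * V ^ Suc m) + smult ((real m)\<^sup>2) (U ^ Suc j * V ^ (m - 1))
        + smult (2 * real j * real m + real j + real m) (U ^ j * V ^ m))" (is "?L = ?R")
proof -
  have "poly ?L x = poly ?R x" for x
  proof -
    define u v where "u = poly U x" and "v = poly V x"
    have W: "poly [:1, 0, - 1:] x = - 4 * (u * v)" and Q: "poly [:0, - 2:] x = - 2 * (u + v)"
      by (simp_all add: u_def v_def algebra_simps)
    \<comment> \<open>Exponents such as j - 1 - 1 are truncated at 0, and the accompanying factors
      vanish exactly when truncation occurs.\<close>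
    have *: "real j * (real (j - 1) * (u ^ (j - 1 - 1) * u)) = real j * (real (j - 1) * u ^ (j - 1))"
      "real m * (real (m - 1) * (v ^ (m - 1 - 1) * v)) = real m * (real (m - 1) * v ^ (m - 1))"
      by (cases "j - 1"; simp) (cases "m - 1"; simp)
    have **: "real j * (u ^ (j - 1) * u) = real j * u ^ j" "real m * (v ^ (m - 1) * v) = real m * v ^ m"
      by (cases j; simp) (cases m; simp)
    have ***: "real j * real (j - 1) = real j * (real j - 1)" "real m * real (m - 1) = real m * (real m - 1)"
      by (cases j; simp) (cases m; simp)
    have "poly ?L x
      = - (real j * (real (j - 1) * (u ^ (j - 1 - 1) * u))) * (v ^ m * v)
        - 2 * (real j * (u ^ (j - 1) * u)) * (real m * (v ^ (m - 1) * v))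
        - (u ^ j * u) * (real m * (real (m - 1) * (v ^ (m - 1 - 1) * v)))
        - real j * (u ^ (j - 1) * u) * v ^ m - real j * u ^ (j - 1) * (v ^ m * v)
        - real m * (u ^ j * u) * v ^ (m - 1) - u ^ j * (real m * (v ^ (m - 1) * v))"
      unfolding pderiv_U_V pderiv_add pderiv_smult poly_add poly_mult poly_smult poly_minus poly_power W Q
        u_def[symmetric] v_def[symmetric]
      by (simp add: field_simps)
    also have "\<dots> = - (real j * (real j - 1)) * u ^ (j - 1) * (v ^ m * v)
        - 2 * (real j * u ^ j) * (real m * v ^ m)
        - (u ^ j * u) * (real m * (real m - 1)) * v ^ (m - 1)
        - real j * u ^ j * v ^ m - real j * u ^ (j - 1) * (v ^ m * v)
        - real m * (u ^ j * u) * v ^ (m - 1) - u ^ j * (real m * v ^ m)"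
      unfolding * ** ***[symmetric] by (simp only: mult_ac minus_mult_left)
    also have "\<dots> = poly ?R x"
      unfolding poly_add poly_mult poly_smult poly_minus poly_power u_def[symmetric] v_def[symmetric] power_Suc
      by (simp add: power2_eq_square algebra_simps)
    finally show ?thesis .
  qed
  then show ?thesis by (metis poly_eq_poly_eq_iff ext)
qed

text \<open>The square of (i + 1) C(k, i + 1) = (k - i) C(k, i). It matches the coefficients of
  neighbouring products after an index shift.\<close>

lemma binomial_square_step:
  assumes "i < k"
  shows "(real (k choose Suc i))\<^sup>2 * (real (Suc i))\<^sup>2 = (real (k choose i))\<^sup>2 * (real (k - i))\<^sup>2"
proof -
  have "Suc i * (k choose Suc i) = (k - i) * (k choose i)"
    using binomial_absorb_comp[of k i] binomial_absorption[of i k] by simp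
  then have "real (Suc i) * real (k choose Suc i) = real (k - i) * real (k choose i)"
    by (metis of_nat_mult)
  then show ?thesis by (metis mult.commute power_mult_distrib)
qed

lemma pderiv_sum_polys: "pderiv (sum f A) = (\<Sum>x\<in>A. pderiv (f x))"
  by (induction A rule: infinite_finite_induct) (simp_all add: pderiv_add)

lemma smult_sum_polys: "smult c (sum f A) = (\<Sum>x\<in>A. smult c (f x))"
  by (induction A rule: infinite_finite_induct) (simp_all add: smult_add_right)

lemma legendre_ode:
  "[:1, 0, - 1:] * pderiv (pderiv (legendre k)) + [:0, - 2:] * pderiv (legendre k)
    + smult (real k * (real k + 1)) (legendre k) = 0"
proof -
  define b where "b j = (real (k choose j))\<^sup>2" for j
  let ?e = "\<lambda>j. U ^ j * V ^ (k - j)"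
  have leg: "legendre k = (\<Sum>j\<le>k. smult (b j) (?e j))" by (simp add: legendre_def b_def)
  have pd: "pderiv (\<Sum>j\<le>k. smult (b j) (f j)) = (\<Sum>j\<le>k. smult (b j) (pderiv (f j)))" for f :: "nat \<Rightarrow> real poly"
    by (simp add: pderiv_sum_polys pderiv_smult)
  \<comment> \<open>Shift by j = i + 1. The term j = 0 drops out on the left and the term j = k on
    the right, since their factors vanish.\<close>
  have left: "(\<Sum>j\<le>k. smult (b j * (real j)\<^sup>2) (U ^ (j - 1) * V ^ Suc (k - j)))
      = (\<Sum>j\<le>k. smult (b j * (real (k - j))\<^sup>2) (?e j))"
  proof (cases k)
    case (Suc n)
    have "(\<Sum>j\<le>k. smult (b j * (real j)\<^sup>2) (U ^ (j - 1) * V ^ Suc (k - j)))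
      = (\<Sum>i\<le>n. smult (b (Suc i) * (real (Suc i))\<^sup>2) (U ^ i * V ^ Suc (n - i)))"
      unfolding Suc sum.atMost_Suc_shift by simp
    also have "\<dots> = (\<Sum>i\<le>n. smult (b i * (real (k - i))\<^sup>2) (?e i))"
      unfolding b_def by (intro sum.cong refl) (simp add: binomial_square_step Suc Suc_diff_le del: of_nat_Suc power_Suc binomial_Suc_Suc)
    also have "\<dots> = (\<Sum>j\<le>k. smult (b j * (real (k - j))\<^sup>2) (?e j))"
      unfolding Suc sum.atMost_Suc by simp
    finally show ?thesis .
  qed simp
  have right: "(\<Sum>j\<le>k. smult (b j * (real (k - j))\<^sup>2) (U ^ Suc j * V ^ (k - j - 1)))
      = (\<Sum>j\<le>k. smult (b j * (real j)\<^sup>2) (?e j))"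
  proof (cases k)
    case (Suc n)
    have "(\<Sum>j\<le>k. smult (b j * (real (k - j))\<^sup>2) (U ^ Suc j * V ^ (k - j - 1)))
      = (\<Sum>i\<le>n. smult (b i * (real (k - i))\<^sup>2) (U ^ Suc i * V ^ (n - i)))"
      unfolding Suc sum.atMost_Suc by (simp add: Suc_diff_le del: power_Suc)
    also have "\<dots> = (\<Sum>i\<le>n. smult (b (Suc i) * (real (Suc i))\<^sup>2) (?e (Suc i)))"
      unfolding b_def by (intro sum.cong refl) (simp add: binomial_square_step Suc del: of_nat_Suc power_Suc binomial_Suc_Suc)
    also have "\<dots> = (\<Sum>j\<le>k. smult (b j * (real j)\<^sup>2) (?e j))"
      unfolding Suc sum.atMost_Suc_shift by simp
    finally show ?thesis .
  qed simp
  have "[:1, 0, - 1:] * pderiv (pderiv (legendre k)) + [:0, - 2:] * pderiv (legendre k)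
    = (\<Sum>j\<le>k. smult (b j) ([:1, 0, - 1:] * pderiv (pderiv (?e j)) + [:0, - 2:] * pderiv (?e j)))"
    unfolding leg pd by (simp only: sum_distrib_left mult_smult_right smult_add_right sum.distrib)
  also have "\<dots> = - ((\<Sum>j\<le>k. smult (b j * (real j)\<^sup>2) (U ^ (j - 1) * V ^ Suc (k - j)))
      + (\<Sum>j\<le>k. smult (b j * (real (k - j))\<^sup>2) (U ^ Suc j * V ^ (k - j - 1)))
      + (\<Sum>j\<le>k. smult (b j * (2 * real j * real (k - j) + real j + real (k - j))) (?e j)))"
    unfolding legendre_operator_term
    by (simp only: smult_minus_right smult_add_right smult_smult sum_negf sum.distrib)
  also have "\<dots> = - (\<Sum>j\<le>k. smult (b j * (real (k - j))\<^sup>2 + b j * (real j)\<^sup>2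
      + b j * (2 * real j * real (k - j) + real j + real (k - j))) (?e j))"
    unfolding left right by (simp only: smult_add_left sum.distrib)
  also have "\<dots> = - smult (real k * (real k + 1)) (legendre k)"
    unfolding leg smult_sum_polys smult_smult
  proof (intro arg_cong[of _ _ uminus] sum.cong refl arg_cong2[of _ _ _ _ smult])
    \<comment> \<open>The squares and the mixed terms combine to (j + (k - j))^2 + j + (k - j) = k
      (k + 1).\<close>
    fix j assume "j \<in> {..k}"
    then show "b j * (real (k - j))\<^sup>2 + b j * (real j)\<^sup>2 + b j * (2 * real j * real (k - j) + real j + real (k - j))
      = real k * (real k + 1) * b j"
      by (simp add: of_nat_diff power2_eq_square algebra_simps)
  qed
  finally show ?thesis by simp
qed

lemma legendre_nonzero: "legendre k \<noteq> 0"
proof -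
  have "poly (legendre k) 1 = (\<Sum>j\<le>k. if j = 0 then 1 else 0)"
    by (simp add: legendre_def poly_sum poly_power)
  then have "poly (legendre k) 1 = 1" by simp
  then show ?thesis by auto
qed

interpretation legendre: diffusion_weight "ereal (- 1)" "ereal 1" "\<lambda>_. 1 / 2" "[:1, 0, - 1:]" "[:0, - 2:]"
proof
  show "0 < poly [:1, 0, - 1:] x" if "x \<in> einterval (ereal (- 1)) (ereal 1)" for x
    using that abs_square_less_1[of x] by (auto simp: power2_eq_square)
  show "((\<lambda>x. poly [:1, 0, - 1:] x * (1 / 2)) has_real_derivative poly [:0, - 2:] x * (1 / 2)) (at x)" for x
  proof -
    have "pderiv [:1, 0, - 1:] = [:0, - 2 :: real:]" by (simp add: pderiv_pCons)
    then show ?thesis using DERIV_cmult_right[OF poly_DERIV[of "[:1, 0, - 1:]" x], of "1 / 2"] by simp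
  qed
  show "set_integrable lborel (einterval (ereal (- 1)) (ereal 1)) (\<lambda>x. poly r x * (1 / 2))" for r
    unfolding einterval_eq
    by (rule set_integrable_subset[of _ "{- 1..1}"])
      (auto intro!: borel_integrable_atLeastAtMost' continuous_intros)
  have lim: "((\<lambda>x. poly r x * (poly [:1, 0, - 1:] x * (1 / 2))) \<longlongrightarrow> 0) (at y within S)"
    if "y = 1 \<or> y = - 1" for r :: "real poly" and y S
  proof -
    have "((\<lambda>x. poly r x * (poly [:1, 0, - 1:] x * (1 / 2))) \<longlongrightarrow> poly r y * (poly [:1, 0, - 1:] y * (1 / 2))) (at y within S)"
      by (intro tendsto_intros)
    then show ?thesis using that by auto
  qed
  show "(((\<lambda>x. poly r x * (poly [:1, 0, - 1:] x * (1 / 2))) \<circ> real_of_ereal) \<longlongrightarrow> 0) (at_right (ereal (- 1)))" for r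
    unfolding ereal_tendsto_simps by (intro lim) simp
  show "(((\<lambda>x. poly r x * (poly [:1, 0, - 1:] x * (1 / 2))) \<circ> real_of_ereal) \<longlongrightarrow> 0) (at_left (ereal 1))" for r
    unfolding ereal_tendsto_simps by (intro lim) simp
qed auto

lemma legendre_measure: "legendre.M = jacobi_measure 0 0"
  unfolding legendre.M_def jacobi_measure_def einterval_eq
proof (rule density_cong)
  show "AE x in restrict_space lborel {- 1<..<1}. ennreal (1 / 2)
      = ennreal (Gamma (0 + 0 + 2) / (2 powr (0 + 0 + 1) * Gamma (0 + 1) * Gamma (0 + 1)) * (1 - x) powr 0 * (1 + x) powr 0)"
    by (auto simp: AE_restrict_space_iff Gamma_numeral)
qed (intro measurable_restrict_space1; measurable)+

lemma integral_legendre_square_pos: "0 < (LINT x|legendre.M. (poly (legendre k) x)\<^sup>2)"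
\<comment> \<open>Degree 0 has eigenvalue 0, outside the scope of
  \<open>eigenpoly_norm_pos\<close>.\<close>
proof (cases "k = 0")
  case True
  have "(LINT x|legendre.M. (poly (legendre 0) x)\<^sup>2) = 1"
    by (subst legendre.integral_M) (simp_all add: legendre_def set_lebesgue_integral_def one_pCons)
  then show ?thesis using True by simp
next
  case False
  then show ?thesis
    by (intro legendre.eigenpoly_norm_pos[OF legendre_ode] legendre_nonzero) (simp add: add_pos_pos)
qed

section \<open>Transfer of the constant\<close>

text \<open>Connects the orthonormal setting of the locale with semigroups written in unnormalized
  polynomials: the two factors 1 / sqrt(\<open>n k\<close>) in the kernel recombine to the division
  by the squared norm.\<close>

lemma (in diffusion_weight) eigenpolys_normalized:
  assumes ode: "\<And>k. W * pderiv (pderiv (q k)) + Q * pderiv (q k) + smult (\<Lambda> k) (q k) = 0"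
    and L: "\<And>k. real k \<le> \<Lambda> k" "inj \<Lambda>"
    and n: "\<And>k. 0 < n k" "\<And>k. (LINT x|M. (poly (q k) x)\<^sup>2) = n k"
    and q0: "pderiv (q 0) = 0"
  shows "eigenpolys a b \<rho> W Q (\<lambda>k. smult (1 / sqrt (n k)) (q k)) \<Lambda>"
    and "eigenpolys.T a b \<rho> (\<lambda>k. smult (1 / sqrt (n k)) (q k)) \<Lambda> t f x
      = (LINT y|M. (\<Sum>k. exp (- \<Lambda> k * t) / n k * poly (q k) x * poly (q k) y) * f y)"
proof -
  show *: "eigenpolys a b \<rho> W Q (\<lambda>k. smult (1 / sqrt (n k)) (q k)) \<Lambda>"
  proof unfold_locales
    fix k
    have eq: "W * pderiv (pderiv (smult c (q k)))
        + Q * pderiv (smult c (q k)) + smult (\<Lambda> k) (smult c (q k))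
      = smult c (W * pderiv (pderiv (q k)) + Q * pderiv (q k) + smult (\<Lambda> k) (q k))" for c
      by (simp add: pderiv_smult smult_add_right mult.commute)
    show "W * pderiv (pderiv (smult (1 / sqrt (n k)) (q k)))
        + Q * pderiv (smult (1 / sqrt (n k)) (q k))
        + smult (\<Lambda> k) (smult (1 / sqrt (n k)) (q k)) = 0"
      unfolding eq ode by simp
    have "(LINT x|M. (poly (smult (1 / sqrt (n k)) (q k)) x)\<^sup>2) = (LINT x|M. 1 / n k * (poly (q k) x)\<^sup>2)"
      using n(1)[of k] by (simp add: power_divide)
    also have "\<dots> = 1" using n(1)[of k] by (simp only: integral_mult_right_zero n(2)) simp
    finally show "(LINT x|M. (poly (smult (1 / sqrt (n k)) (q k)) x)\<^sup>2) = 1" .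
  qed (use L q0 in \<open>auto simp: pderiv_smult\<close>)
  have "exp (- \<Lambda> k * t) * poly (smult (1 / sqrt (n k)) (q k)) x * poly (smult (1 / sqrt (n k)) (q k)) y
    = exp (- \<Lambda> k * t) / n k * poly (q k) x * poly (q k) y" for k y
    using n(1)[of k] by (simp add: field_simps)
  then show "eigenpolys.T a b \<rho> (\<lambda>k. smult (1 / sqrt (n k)) (q k)) \<Lambda> t f x
      = (LINT y|M. (\<Sum>k. exp (- \<Lambda> k * t) / n k * poly (q k) x * poly (q k) y) * f y)"
    unfolding eigenpolys.T_def[OF *] by (simp only:)
qed

text \<open>At \<alpha> = \<beta> = 0 the eigenvalue is k (k + 1) and \<open>jacobi_hhat\<close> is
  by definition the squared norm, so positivity of that norm is enough to identify the semigroup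
  with the one of the locale.\<close>

lemma jacobi_constant_lower_bound:
  assumes "\<And>f. f \<in> L2_space (jacobi_measure 0 0) \<Longrightarrow>
       L2_norm (jacobi_measure 0 0) (jacobi_g 0 0 f) \<le> ennreal C * L2_norm_real (jacobi_measure 0 0) f"
  shows "sqrt (1 / 2) \<le> C"
proof -
  let ?L = "\<lambda>k. real k * (real k + 1)"
  have "real k \<le> ?L k" for k by (simp add: algebra_simps)
  moreover have "strict_mono ?L" by (auto simp: strict_mono_Suc_iff algebra_simps)
  then have "inj ?L" by (rule strict_mono_imp_inj_on)
  moreover have "pderiv (legendre 0) = 0" by (simp add: legendre_def one_pCons pderiv_pCons)
  ultimately have *: "eigenpolys (ereal (- 1)) (ereal 1) (\<lambda>_. 1 / 2) [:1, 0, - 1:] [:0, - 2:]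
      (\<lambda>k. smult (1 / sqrt (LINT x|legendre.M. (poly (legendre k) x)\<^sup>2)) (legendre k)) ?L"
    and T: "eigenpolys.T (ereal (- 1)) (ereal 1) (\<lambda>_. 1 / 2)
      (\<lambda>k. smult (1 / sqrt (LINT x|legendre.M. (poly (legendre k) x)\<^sup>2)) (legendre k)) ?L t f x
      = (LINT y|legendre.M. (\<Sum>k. exp (- ?L k * t) / (LINT x|legendre.M. (poly (legendre k) x)\<^sup>2)
          * poly (legendre k) x * poly (legendre k) y) * f y)" for t f x
    by (rule legendre.eigenpolys_normalized[OF legendre_ode _ _ integral_legendre_square_pos refl])+
  interpret eigenpolys "ereal (- 1)" "ereal 1" "\<lambda>_. 1 / 2" "[:1, 0, - 1:]" "[:0, - 2:]"
    "\<lambda>k. smult (1 / sqrt (LINT x|legendre.M. (poly (legendre k) x)\<^sup>2)) (legendre k)" ?L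
    by (rule *)
  have "T = jacobi_semigroup 0 0"
    by (intro ext, subst T) (simp only: jacobi_semigroup_def legendre_measure poly_legendre jacobi_hhat_def jacobi_lambda_def add_0_right)
  moreover have "poly [:1, 0, - 1:] = (\<lambda>x :: real. 1 - x\<^sup>2)"
    by (simp add: fun_eq_iff power2_eq_square)
  ultimately have "g = jacobi_g 0 0" by (simp only: jacobi_g_def)
  then show ?thesis
    using L2_norm_g_bound_constant_ge[of C] assms[of "poly (smult (1 / sqrt (LINT x|legendre.M. (poly (legendre 1) x)\<^sup>2)) (legendre 1))"]
      poly_L2 unfolding legendre_measure[symmetric] by (simp only:)
qed

lemma gauss_g_bound:
  assumes "sqrt (1 / 2) \<le> C" "f \<in> L2_space gauss_measure"
  shows "L2_norm gauss_measure (gauss_g f) \<le> ennreal C * L2_norm_real gauss_measure f"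
proof -
  let ?n = "\<lambda>k. 2 ^ k * fact k :: real"
  have "(LINT x|hermite.M. (poly (hermite k) x)\<^sup>2) = ?n k" for k
    using integral_hermite_square[of k] by (simp add: power2_eq_square)
  moreover have "inj real" by (rule inj_of_nat)
  moreover have "pderiv (hermite 0) = 0" by (simp add: hermite_def one_pCons pderiv_pCons)
  ultimately have *: "eigenpolys (- \<infinity>) \<infinity> (\<lambda>x. exp (- x\<^sup>2) / sqrt pi) [:1 / 2:] [:0, - 1:]
      (\<lambda>k. smult (1 / sqrt (?n k)) (hermite k)) real"
    and T: "eigenpolys.T (- \<infinity>) \<infinity> (\<lambda>x. exp (- x\<^sup>2) / sqrt pi) (\<lambda>k. smult (1 / sqrt (?n k)) (hermite k)) real t f x
      = (LINT y|hermite.M. (\<Sum>k. exp (- real k * t) / ?n k * poly (hermite k) x * poly (hermite k) y) * f y)" for t f x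
    by (intro hermite.eigenpolys_normalized[OF hermite_ode order_refl]; simp)+
  interpret eigenpolys "- \<infinity>" \<infinity> "\<lambda>x. exp (- x\<^sup>2) / sqrt pi" "[:1 / 2:]" "[:0, - 1:]"
    "\<lambda>k. smult (1 / sqrt (?n k)) (hermite k)" real
    by (rule *)
  have "T = hermite_semigroup"
    by (intro ext, subst T) (simp only: hermite_semigroup_def hermite_measure poly_hermite)
  moreover have "poly [:1 / 2:] = (\<lambda>x :: real. 1 / 2)"
    by (simp add: fun_eq_iff)
  ultimately have "g = gauss_g" by (simp only: gauss_g_def)
  then show ?thesis
    using L2_norm_g_le[of f C] assms unfolding hermite_measure by simp
qed

lemma laguerre_g_bound:
  assumes "sqrt (1 / 2) \<le> C" "\<alpha> > - 1" "f \<in> L2_space (laguerre_measure \<alpha>)"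
  shows "L2_norm (laguerre_measure \<alpha>) (laguerre_g \<alpha> f) \<le> ennreal C * L2_norm_real (laguerre_measure \<alpha>) f"
proof -
  interpret D: diffusion_weight 0 \<infinity> "laguerre_density \<alpha>" "[:0, 1:]" "[:\<alpha> + 1, - 1:]"
    by (rule laguerre_weight[OF \<open>\<alpha> > - 1\<close>])
  let ?n = "\<lambda>k. Gamma (real k + \<alpha> + 1) / (Gamma (\<alpha> + 1) * fact k)"
  have G: "0 < Gamma (real k + \<alpha> + 1)" for k using \<open>\<alpha> > - 1\<close> by (intro Gamma_real_pos) simp
  have n: "0 < ?n k" for k using G[of 0] G[of k] by simp
  have sq: "(LINT x|D.M. (poly (laguerre \<alpha> k) x)\<^sup>2) = ?n k" for k
    using integral_laguerre_square[OF \<open>\<alpha> > - 1\<close>, of k] unfolding laguerre_measure_eq[OF \<open>\<alpha> > - 1\<close>]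
    by (simp add: power2_eq_square)
  have p0: "pderiv (laguerre \<alpha> 0) = 0" by (simp add: laguerre_def one_pCons pderiv_pCons)
  note * = D.eigenpolys_normalized[OF laguerre_ode order_refl inj_of_nat n sq p0]
  interpret eigenpolys 0 \<infinity> "laguerre_density \<alpha>" "[:0, 1:]" "[:\<alpha> + 1, - 1:]"
    "\<lambda>k. smult (1 / sqrt (?n k)) (laguerre \<alpha> k)" real
    by (rule *(1))
  have "exp (- real k * t) / ?n k = exp (- real k * t) * (Gamma (\<alpha> + 1) * fact k / Gamma (real k + \<alpha> + 1))" for k t
    by simp
  then have "T = laguerre_semigroup \<alpha>"
    by (intro ext, subst *(2)) (simp only: laguerre_semigroup_def laguerre_measure_eq[OF \<open>\<alpha> > - 1\<close>] poly_laguerre)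
  moreover have "poly [:0, 1:] = (\<lambda>x :: real. x)"
    by (simp add: fun_eq_iff)
  ultimately have "g = laguerre_g \<alpha>" by (simp only: laguerre_g_def)
  then show ?thesis
    using L2_norm_g_le[of f C] assms unfolding laguerre_measure_eq[OF \<open>\<alpha> > - 1\<close>] by simp
qed

theorem theorem2p1:
  fixes C2 :: real
  assumes jacobi_bound:
    "\<And>\<alpha> \<beta> f. \<alpha> > -1 \<Longrightarrow> \<beta> > -1 \<Longrightarrow> f \<in> L2_space (jacobi_measure \<alpha> \<beta>) \<Longrightarrow>
       L2_norm (jacobi_measure \<alpha> \<beta>) (jacobi_g \<alpha> \<beta> f)
         \<le> ennreal C2 * L2_norm_real (jacobi_measure \<alpha> \<beta>) f"
  shows "(\<forall>f \<in> L2_space gauss_measure.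
            L2_norm gauss_measure (gauss_g f) \<le> ennreal C2 * L2_norm_real gauss_measure f) \<and>
         (\<forall>\<alpha> > -1. \<forall>f \<in> L2_space (laguerre_measure \<alpha>).
            L2_norm (laguerre_measure \<alpha>) (laguerre_g \<alpha> f)
              \<le> ennreal C2 * L2_norm_real (laguerre_measure \<alpha>) f)"
proof -
  have "sqrt (1 / 2) \<le> C2"
    by (rule jacobi_constant_lower_bound) (rule jacobi_bound; simp)
  then show ?thesis using gauss_g_bound laguerre_g_bound by blast
qed

end
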